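(* Let $n>4$ be an integer, $\lambda\ge 0$, $\alpha=\sqrt{n}-1$, $c_0>0$, $c_1\in\mathbb{R}$ and $c_2:=\frac{(n-1)(\alpha-1)}{2}$. Then there exists a constant $0<\delta_0<1$ such that there is a unique function $h\in C^2((0,\infty))$ with all of the following properties: (i) $h(r)>0$ and $2r^2h(r)h_{rr}(r)=(n-1)h(r)(h(r)-1)+rh_r(r)\big(rh_r(r)-\lambda r-(n-1)\big)$ for all $r\in(0,\infty)$; (ii) $\lim_{r\to 0^+}r^{\alpha}h(r)=c_0$; (iii) for $0<r\le\delta_0$, $$h(r)=\frac{1}{r^{\alpha}}\left\{c_0-\frac{c_2}{\alpha}r^{\alpha}+\left(\frac{c_1}{\alpha+1}-\frac{\alpha\lambda}{2(\alpha+1)^2}\right)r^{\alpha+1}+\frac{\alpha\lambda}{2\alpha+2}r^{\alpha+1}\log r+\frac{c_2^2+(n-1)c_2}{4c_0\alpha(\alpha-1)}r^{2\alpha}+o(1)r^{2\alpha}\right\}.$$ Moreover, for this $h$ and $0<r\le\delta_0$, $$h_r(r)=\frac{1}{r^{\alpha+1}}\left\{-\alpha c_0+\left(\frac{c_1}{\alpha+1}+\frac{\alpha^2\lambda}{2(\alpha+1)^2}\right)r^{\alpha+1}+\frac{\alpha\lambda}{2\alpha+2}r^{\alpha+1}\log r+\frac{c_2^2+(n-1)c_2}{4c_0(\alpha-1)}r^{2\alpha}+o(1)r^{2\alpha}\right\}.$$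
   Context: Subscripts $r$ denote derivatives with respect to $r$. Each $o(1)$ denotes a function of $r$ tending to $0$ as $r\to0^+$. *)

theory Defs
  imports "HOL-Analysis.Analysis"
begin

definition C2_on :: "(real \<Rightarrow> real) \<Rightarrow> real set \<Rightarrow> bool" where
  "C2_on h S \<longleftrightarrow> h C1_differentiable_on S \<and> deriv h C1_differentiable_on S"

definition positive_ode_solution :: "nat \<Rightarrow> real \<Rightarrow> (real \<Rightarrow> real) \<Rightarrow> bool" where
  "positive_ode_solution n l h \<longleftrightarrow>
     (\<forall>r>0. h r > 0 \<and>
        2 * r^2 * h r * deriv (deriv h) r =
          (real n - 1) * h r * (h r - 1)
          + r * deriv h r * (r * deriv h r - l * r - (real n - 1)))"

text \<open>In the two expansions below, \<open>e\<close> is the remainder written \<open>o(1)\<close>: a function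
  tending to \<open>0\<close> at \<open>0+\<close>, with the identity holding exactly on \<open>(0, d]\<close>.
  The parameters are \<open>n\<close>, \<open>l = \<lambda>\<close>, \<open>a = \<alpha>\<close>, \<open>c0\<close>, \<open>c1\<close>, \<open>c2\<close> and \<open>d = \<delta>\<^sub>0\<close>.\<close>

definition h_expansion ::
  "nat \<Rightarrow> real \<Rightarrow> real \<Rightarrow> real \<Rightarrow> real \<Rightarrow> real \<Rightarrow> real \<Rightarrow> (real \<Rightarrow> real) \<Rightarrow> bool" where
  "h_expansion n l a c0 c1 c2 d h \<longleftrightarrow>
     (\<exists>e :: real \<Rightarrow> real. (e \<longlongrightarrow> 0) (at_right 0) \<and>
       (\<forall>r. 0 < r \<and> r \<le> d \<longrightarrow>
          h r = 1 / r powr a *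
            (c0 - c2 / a * r powr a
             + (c1 / (a + 1) - a * l / (2 * (a + 1)^2)) * r powr (a + 1)
             + a * l / (2 * a + 2) * r powr (a + 1) * ln r
             + (c2^2 + (real n - 1) * c2) / (4 * c0 * a * (a - 1)) * r powr (2 * a)
             + e r * r powr (2 * a))))"

definition deriv_expansion ::
  "nat \<Rightarrow> real \<Rightarrow> real \<Rightarrow> real \<Rightarrow> real \<Rightarrow> real \<Rightarrow> real \<Rightarrow> (real \<Rightarrow> real) \<Rightarrow> bool" where
  "deriv_expansion n l a c0 c1 c2 d h \<longleftrightarrow>
     (\<exists>e :: real \<Rightarrow> real. (e \<longlongrightarrow> 0) (at_right 0) \<and>
       (\<forall>r. 0 < r \<and> r \<le> d \<longrightarrow>
          deriv h r = 1 / r powr (a + 1) *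
            (- a * c0
             + (c1 / (a + 1) + a^2 * l / (2 * (a + 1)^2)) * r powr (a + 1)
             + a * l / (2 * a + 2) * r powr (a + 1) * ln r
             + (c2^2 + (real n - 1) * c2) / (4 * c0 * (a - 1)) * r powr (2 * a)
             + e r * r powr (2 * a))))"

text \<open>A function on \<open>(0, \<infinity>)\<close> is encoded by a total function whose values on
  \<open>(-\<infinity>, 0]\<close> are irrelevant. Since \<open>(0, \<infinity>)\<close> is open, \<^const>\<open>deriv\<close> at \<open>r > 0\<close>
  does not see those values either; uniqueness has to be read as equality on \<open>(0, \<infinity>)\<close>.\<close>

definition admissible ::
  "nat \<Rightarrow> real \<Rightarrow> real \<Rightarrow> real \<Rightarrow> real \<Rightarrow> real \<Rightarrow> real \<Rightarrow> (real \<Rightarrow> real) \<Rightarrow> bool" where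
  "admissible n l a c0 c1 c2 d h \<longleftrightarrow>
     C2_on h {0<..} \<and>
     positive_ode_solution n l h \<and>
     ((\<lambda>r. r powr a * h r) \<longlongrightarrow> c0) (at_right 0) \<and>
     h_expansion n l a c0 c1 c2 d h"

end

(* Writing h = f^2 turns the equation into 4 r^2 f'' = (n-1) f - (n-1)/f - 2 r f' (l r + n - 1)/f^2,
   which is linear in f'. With f = r^(-a/2) u and a second unknown v obtained from u' by two
   integrations by parts, it becomes a first-order system in (u, v) whose right-hand side is r^(a-2)
   times a function continuous up to r = 0; in the time r^(a-1) it is a regular initial value problem
   with u(0) = sqrt c0 and v(0) = c1/(2 sqrt c0), so c0 and c1 parametrize its solutions.
   The solution is global because 1/(sqrt r f) stays bounded on bounded intervals (this uses n > 4).
   The expansions follow from (r^a h)' = 2 r^a u v - 2 r^(a-1) (A - B r ln r), A and B constants.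
   For uniqueness, an arbitrary admissible g yields a solution (u, v) of the system with
   u -> sqrt c0, and its expansion forces v -> c1/(2 sqrt c0), so it is the solution above. *)
theory Submission
  imports Defs
begin

section \<open>Initial value problems with Lipschitz right-hand side\<close>

text \<open>The linear part 4 r^2 f'' = (n-1) f has power solutions r^s with 4 s (s-1) = n-1, that
  is s = -a/2 and s = 1 + a/2, because n = (a+1)^2. The first corresponds to constant u; relative to
  it the second has size r^(a+1), so c1 appears only at that order, behind the term in r^a. In u the
  equation reads (r^-a u')' = (A + B r)/(r^2 u) - (l r + n - 1) u'/(2 r u^2). The term A/r^2
  produces the r^a correction, and B/r, resonant with the second exponent, produces the logarithm.
  Neither is integrable at 0, so their primitive has to be moved into v. What remains in v' carries
  r^(a-2), integrable since a > 1 but unbounded when a < 2; hence the change of time. The system is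
  affine in v, so a solution can stop only by u approaching 0; the whole global existence question
  is a lower bound for u. In the uniqueness part the obstacle is that only h, not h', is expanded:
  nothing is known about v beforehand, not even that it is bounded, and its limit must be extracted
  from increments of h.\<close>

lemma picard_lindelof_lipschitz:
  fixes G :: "real \<Rightarrow> 'a::euclidean_space \<Rightarrow> 'a"
  assumes T: "0 \<le> T" and L: "0 < L"
    and cont: "continuous_on ({0..T} \<times> UNIV) (\<lambda>(t, x). G t x)"
    and lip: "\<And>t x y. t \<in> {0..T} \<Longrightarrow> norm (G t x - G t y) \<le> L * norm (x - y)"
  obtains X where "continuous_on {0..T} X" "X 0 = x0"
    "\<And>t. t \<in> {0<..<T} \<Longrightarrow> (X has_vector_derivative G t (X t)) (at t)"
proof -
  \<comment> \<open>The fixed point is sought for y(t) = exp(-b t) X(t). With b = 2 L the integral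
    of L exp(b s) over [0, u] is at most exp(b u)/2, so the Picard map is a contraction with factor
    1/2 on all of [0, T], whatever T is.\<close>
  define b where "b = 2 * L"
  \<comment> \<open>Clamping time to [0, T] turns functions on the interval into bounded continuous
    functions on the whole line, a complete space on which Banach's theorem applies.\<close>
  define c :: "real \<Rightarrow> real" where "c t = max 0 (min T t)" for t
  define J where "J y u = x0 + integral {0..u} (\<lambda>s. G s (exp (b * s) *\<^sub>R y s))"
    for y :: "real \<Rightarrow> 'a" and u
  define Q where "Q y t = exp (- b * c t) *\<^sub>R J y (c t)" for y :: "real \<Rightarrow> 'a" and t
  have b: "b > 0" using L by (simp add: b_def)
  have c_mem: "c t \<in> {0..T}" for t using T by (auto simp: c_def)
  have c_id: "c t = t" if "t \<in> {0..T}" for t using that by (auto simp: c_def)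
  have cont_c: "continuous_on UNIV c" unfolding c_def by (intro continuous_intros)
  have cont_int: "continuous_on {0..T} (\<lambda>s. G s (exp (b * s) *\<^sub>R y s))"
    if "continuous_on {0..T} y" for y
  proof -
    have "continuous_on {0..T} (\<lambda>s. (s, exp (b * s) *\<^sub>R y s))"
      by (intro continuous_intros that)
    from continuous_on_compose2[OF cont this] show ?thesis by auto
  qed
  have cont_J: "continuous_on {0..T} (J y)" if "continuous_on {0..T} y" for y
    unfolding J_def
    by (intro continuous_intros indefinite_integral_continuous_1 integrable_continuous_real
        cont_int that)
  have Q_bcont: "Q (apply_bcontfun y) \<in> bcontfun" for y :: "real \<Rightarrow>\<^sub>C 'a"
  proof -
    have *: "continuous_on {0..T} (\<lambda>u. exp (- b * u) *\<^sub>R J y u)"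
      by (intro continuous_intros cont_J) simp
    have "continuous_on UNIV (Q y)"
      unfolding Q_def
      by (rule continuous_on_compose2[OF * cont_c]) (use c_mem in blast)
    moreover have "bounded ((\<lambda>u. exp (- b * u) *\<^sub>R J y u) ` {0..T})"
      by (intro compact_imp_bounded compact_continuous_image * compact_Icc)
    then have "bounded (range (Q y))"
      by (rule bounded_subset) (use c_mem in \<open>auto simp: Q_def\<close>)
    ultimately show ?thesis by (simp add: bcontfun_def)
  qed
  define P where "P y = Bcontfun (Q (apply_bcontfun y))" for y
  have P_apply: "apply_bcontfun (P y) = Q y" for y
    unfolding P_def using Q_bcont by (simp add: Bcontfun_inverse)
  have "dist (P y) (P z) \<le> 1 / 2 * dist y z" for y z
  proof (rule dist_bound)
    fix t
    define u where "u = c t"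
    have u: "u \<in> {0..T}" unfolding u_def by (rule c_mem)
    define gy where "gy s = G s (exp (b * s) *\<^sub>R y s)" for s
    define gz where "gz s = G s (exp (b * s) *\<^sub>R z s)" for s
    have int_y: "gy integrable_on {0..u}" and int_z: "gz integrable_on {0..u}"
      unfolding gy_def gz_def using u
      by (auto intro!: integrable_continuous_real
          continuous_on_subset[OF cont_int[of y]] continuous_on_subset[OF cont_int[of z]])
    have exp_int: "((\<lambda>s. L * dist y z * exp (b * s)) has_integral
        L * dist y z / b * exp (b * u) - L * dist y z / b * exp (b * 0)) {0..u}"
    proof (rule fundamental_theorem_of_calculus)
      show "0 \<le> u" using u by simp
      fix s
      show "((\<lambda>s. L * dist y z / b * exp (b * s)) has_vector_derivative
          L * dist y z * exp (b * s)) (at s within {0..u})"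
        unfolding has_real_derivative_iff_has_vector_derivative[symmetric]
        using b by (auto intro!: derivative_eq_intros)
    qed
    have "norm (integral {0..u} gy - integral {0..u} gz) = norm (integral {0..u} (\<lambda>s. gy s - gz s))"
      by (simp add: integral_diff int_y int_z)
    also have "\<dots> \<le> integral {0..u} (\<lambda>s. L * dist y z * exp (b * s))"
    proof (rule integral_norm_bound_integral)
      show "(\<lambda>s. gy s - gz s) integrable_on {0..u}" by (intro integrable_diff int_y int_z)
      show "(\<lambda>s. L * dist y z * exp (b * s)) integrable_on {0..u}" using exp_int by blast
      fix s assume s: "s \<in> {0..u}"
      have "norm (gy s - gz s) \<le> L * norm (exp (b * s) *\<^sub>R y s - exp (b * s) *\<^sub>R z s)"
        unfolding gy_def gz_def using s u by (intro lip) auto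
      also have "\<dots> = L * (exp (b * s) * dist (y s) (z s))"
        by (simp add: dist_norm flip: scaleR_diff_right)
      also have "\<dots> \<le> L * (exp (b * s) * dist y z)"
        using L by (intro mult_left_mono dist_bounded) auto
      finally show "norm (gy s - gz s) \<le> L * dist y z * exp (b * s)"
        by (simp add: mult_ac)
    qed
    also have "\<dots> = L * dist y z / b * exp (b * u) - L * dist y z / b"
      by (subst integral_unique[OF exp_int]) simp
    also have "\<dots> \<le> 1 / 2 * dist y z * exp (b * u)"
      using L by (simp add: b_def)
    finally have *: "norm (integral {0..u} gy - integral {0..u} gz) \<le> 1 / 2 * dist y z * exp (b * u)" .
    have "dist (P y t) (P z t) = exp (- b * u) * norm (integral {0..u} gy - integral {0..u} gz)"
      unfolding P_apply Q_def J_def dist_norm u_def[symmetric] gy_def[symmetric] gz_def[symmetric]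
      by (simp flip: scaleR_diff_right)
    also have "\<dots> \<le> exp (- b * u) * (1 / 2 * dist y z * exp (b * u))"
      by (intro mult_left_mono *) simp
    also have "\<dots> = 1 / 2 * dist y z"
      by (simp add: exp_minus)
    finally show "dist (P y t) (P z t) \<le> 1 / 2 * dist y z" .
  qed
  then obtain y where "P y = y"
    using banach_fix_type[of "1/2" P] by auto
  then have y_eq: "y t = Q y t" for t
    by (metis P_apply)
  define X where "X t = exp (b * t) *\<^sub>R y t" for t
  have X_eq: "X t = x0 + integral {0..t} (\<lambda>s. G s (X s))" if "t \<in> {0..T}" for t
  proof -
    have "X t = exp (b * t) *\<^sub>R Q y t" using y_eq[of t] by (simp add: X_def)
    then show ?thesis
      by (simp add: Q_def J_def X_def c_id[OF that] exp_minus)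
  qed
  have cont_X: "continuous_on {0..T} X"
    unfolding X_def by (intro continuous_intros continuous_on_apply_bcontfun)
  have cont_GX: "continuous_on {0..T} (\<lambda>s. G s (X s))"
    unfolding X_def by (intro cont_int) simp
  show thesis
  proof
    show "continuous_on {0..T} X" by (fact cont_X)
    show "X 0 = x0" using X_eq[of 0] T by simp
    fix t assume t: "t \<in> {0<..<T}"
    have "((\<lambda>u. x0 + integral {0..u} (\<lambda>s. G s (X s))) has_vector_derivative 0 + G t (X t))
        (at t within {0..T})"
      using t by (intro has_vector_derivative_add has_vector_derivative_const
          integral_has_vector_derivative cont_GX) auto
    from has_vector_derivative_transform[OF _ X_eq this]
    have "(X has_vector_derivative G t (X t)) (at t within {0..T})"
      using t by auto
    moreover have "at t within {0..T} = at t"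
      using t by (intro at_within_interior) (simp add: interior_atLeastAtMost_real)
    ultimately show "(X has_vector_derivative G t (X t)) (at t)" by simp
  qed
qed

text \<open>Gronwall in differential form: |X - Y|^2 exp(-2 L t) does not increase. The Lipschitz
  estimate is asked for only along the two trajectories and derivatives only in the interior, so at
  t = 0 continuity suffices.\<close>

lemma ode_unique:
  fixes X Y :: "real \<Rightarrow> 'a::euclidean_space"
  assumes "continuous_on {0..T} X" "continuous_on {0..T} Y" "X 0 = Y 0" "0 \<le> T"
    and "\<And>t. t \<in> {0<..<T} \<Longrightarrow> (X has_vector_derivative G t (X t)) (at t)"
    and "\<And>t. t \<in> {0<..<T} \<Longrightarrow> (Y has_vector_derivative G t (Y t)) (at t)"
    and lip: "\<And>t. t \<in> {0<..<T} \<Longrightarrow> norm (G t (X t) - G t (Y t)) \<le> L * norm (X t - Y t)"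
  shows "X T = Y T"
proof -
  define u where "u t = (X t - Y t) \<bullet> (X t - Y t) * exp (- 2 * L * t)" for t
  have "u T \<le> u 0"
  proof (rule DERIV_nonpos_imp_decreasing_open[OF \<open>0 \<le> T\<close>])
    show "continuous_on {0..T} u"
      unfolding u_def by (intro continuous_intros assms)
    fix t assume t: "0 < t" "t < T"
    define D where "D = G t (X t) - G t (Y t)"
    have "((\<lambda>t. X t - Y t) has_vector_derivative D) (at t)"
      unfolding D_def using t by (intro has_vector_derivative_diff assms) auto
    from has_derivative_inner[OF this[unfolded has_vector_derivative_def]
        this[unfolded has_vector_derivative_def]]
    have d: "((\<lambda>t. (X t - Y t) \<bullet> (X t - Y t)) has_real_derivative
        (X t - Y t) \<bullet> D + D \<bullet> (X t - Y t)) (at t)"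
      unfolding has_real_derivative_iff_has_vector_derivative has_vector_derivative_def
      by (rule has_derivative_eq_rhs) (auto simp: algebra_simps)
    have "((\<lambda>t. exp (- 2 * L * t)) has_real_derivative - 2 * L * exp (- 2 * L * t)) (at t)"
      by (auto intro!: derivative_eq_intros)
    from DERIV_mult[OF d this]
    have "(u has_real_derivative (2 * ((X t - Y t) \<bullet> D)
        - 2 * L * ((X t - Y t) \<bullet> (X t - Y t))) * exp (- 2 * L * t)) (at t)"
      unfolding u_def by (rule DERIV_cong) (simp only: inner_commute[of D] algebra_simps)
    moreover have "(X t - Y t) \<bullet> D \<le> L * ((X t - Y t) \<bullet> (X t - Y t))"
    proof -
      have "(X t - Y t) \<bullet> D \<le> norm (X t - Y t) * norm D" by (rule norm_cauchy_schwarz)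
      also have "\<dots> \<le> norm (X t - Y t) * (L * norm (X t - Y t))"
        unfolding D_def using t by (intro mult_left_mono lip) auto
      also have "\<dots> = L * ((X t - Y t) \<bullet> (X t - Y t))"
        by (simp add: power2_norm_eq_inner[symmetric] power2_eq_square)
      finally show ?thesis .
    qed
    ultimately show "\<exists>y. DERIV u t :> y \<and> y \<le> 0"
      by (intro exI conjI) (assumption, auto intro!: mult_nonpos_nonneg)
  qed
  also have "u 0 = 0" using \<open>X 0 = Y 0\<close> by (simp add: u_def)
  finally have "(X T - Y T) \<bullet> (X T - Y T) \<le> 0"
    by (simp add: u_def mult_le_0_iff)
  then show ?thesis by (metis inner_ge_zero inner_eq_zero_iff antisym right_minus_eq)
qed

section \<open>Continuation of solutions by truncation and a priori bounds\<close>

definition ode_sol :: "(real \<Rightarrow> 'a::real_normed_vector \<Rightarrow> 'a) \<Rightarrow> 'a \<Rightarrow> real \<Rightarrow> (real \<Rightarrow> 'a) \<Rightarrow> bool" where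
  "ode_sol F x0 T X \<longleftrightarrow> continuous_on {0..<T} X \<and> X 0 = x0 \<and>
     (\<forall>t\<in>{0<..<T}. (X has_vector_derivative F t (X t)) (at t))"

lemma ode_sol_mono: "ode_sol F x0 T X \<Longrightarrow> T' \<le> T \<Longrightarrow> ode_sol F x0 T' X"
  unfolding ode_sol_def by (auto elim: continuous_on_subset)

text \<open>At the first time the truncated solution leaves \<open>U\<close>, the a priori bound still holds by
  closedness of \<open>K\<close>; so there is no such time.\<close>
lemma ode_sol_truncation:
  fixes F G :: "real \<Rightarrow> 'a::euclidean_space \<Rightarrow> 'a"
  assumes T: "0 < T" and L: "0 < L"
    and cont: "continuous_on ({0..T} \<times> UNIV) (\<lambda>(t, x). G t x)"
    and lip: "\<And>t x y. t \<in> {0..T} \<Longrightarrow> norm (G t x - G t y) \<le> L * norm (x - y)"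
    and eq: "\<And>t x. t \<in> {0<..<T} \<Longrightarrow> x \<in> U \<Longrightarrow> G t x = F t x"
    and U: "open U" "x0 \<in> U" and K: "closed K" "K \<subseteq> U"
    and apriori: "\<And>T' Y t. T' \<le> T \<Longrightarrow> ode_sol F x0 T' Y \<Longrightarrow> (\<And>t. t \<in> {0..<T'} \<Longrightarrow> Y t \<in> U)
      \<Longrightarrow> t \<in> {0..<T'} \<Longrightarrow> Y t \<in> K"
  obtains X where "ode_sol F x0 T X" "\<And>t. t \<in> {0..<T} \<Longrightarrow> X t \<in> U"
proof -
  obtain X where X: "continuous_on {0..T} X" "X 0 = x0"
    "\<And>t. t \<in> {0<..<T} \<Longrightarrow> (X has_vector_derivative G t (X t)) (at t)"
    using picard_lindelof_lipschitz[OF less_imp_le[OF T] L cont lip] by metis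
  \<comment> \<open>As long as X stays in U, the truncated field \<open>G\<close> equals
    \<open>F\<close> along it, so X solves the original problem and the a priori bound may be
    applied to it.\<close>
  have sub: "ode_sol F x0 T' X" if "T' \<le> T" "\<And>t. t \<in> {0..<T'} \<Longrightarrow> X t \<in> U" for T'
    unfolding ode_sol_def
  proof (intro conjI ballI)
    show "continuous_on {0..<T'} X" using X(1) that(1) by (auto elim: continuous_on_subset)
    fix t assume "t \<in> {0<..<T'}"
    then show "(X has_vector_derivative F t (X t)) (at t)"
      using X(3)[of t] eq[of t "X t"] that by auto
  qed (fact X)
  have "X t \<in> U" if "t \<in> {0..<T}" for t
  proof (rule ccontr)
    assume "X t \<notin> U"
    define E where "E = {0..T} \<inter> X -` (- U)"
    have "closed E"
      unfolding E_def using X(1) U by (intro continuous_closed_preimage) auto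
    moreover have tE: "t \<in> E" using that \<open>X t \<notin> U\<close> by (auto simp: E_def)
    moreover have bb: "bdd_below E" by (auto simp: E_def intro: bdd_belowI)
    ultimately have "Inf E \<in> E" by (intro closed_contains_Inf) auto
    define s where "s = Inf E"
    have s: "s \<in> {0..T}" "X s \<notin> U" "s \<le> t"
      using \<open>Inf E \<in> E\<close> cInf_lower[OF tE bb] by (auto simp: s_def E_def)
    have inU: "X r \<in> U" if "r \<in> {0..<s}" for r
    proof (rule ccontr)
      assume "X r \<notin> U"
      then have "r \<in> E" using that s by (auto simp: E_def)
      from cInf_lower[OF this bb] that show False by (simp add: s_def)
    qed
    have "s \<noteq> 0" using s U X(2) by auto
    then have "0 < s" using s by auto
    have inK: "X r \<in> K" if "r \<in> {0..<s}" for r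
      using s inU that by (intro apriori[of s X] sub) auto
    have "eventually (\<lambda>r. X r \<in> K) (at_left s)"
      using eventually_at_left_field[of "\<lambda>r. X r \<in> K" s] \<open>0 < s\<close> inK by (auto intro!: exI[of _ 0])
    moreover have "continuous_on {0..s} X"
      using X(1) s by (auto elim: continuous_on_subset)
    then have "(X \<longlongrightarrow> X s) (at_left s)"
      using \<open>0 < s\<close> unfolding continuous_on_def
      by (metis at_within_Icc_at_left atLeastAtMost_iff less_imp_le order_refl)
    ultimately have "X s \<in> K"
      by (rule Lim_in_closed_set[OF K(1) _ trivial_limit_at_left_real])
    with s K show False by auto
  qed
  then show thesis using that sub[of T] by auto
qed

section \<open>Real powers and logarithms near the origin\<close>

lemma DERIV_powr_const:
  "r > 0 \<Longrightarrow> DERIV (\<lambda>r. r powr b) r :> b * r powr b / r" for r b :: real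
  by (auto intro!: derivative_eq_intros simp: powr_diff)

text \<open>The product has value 0 at r = 0, which is also its limit there. This is what makes
  \<open>S\<close> and \<open>D\<close> continuous up to the origin.\<close>

lemma continuous_on_mult_ln: "continuous_on {0..} (\<lambda>r::real. r * ln r)"
proof -
  have "continuous (at r within {0..}) (\<lambda>r::real. r * ln r)" if "r \<ge> 0" for r
  proof (cases "r = 0")
    case True
    have "((\<lambda>r::real. r * ln r) \<longlongrightarrow> 0) (at_right 0)" by real_asymp
    then show ?thesis using True by (simp add: continuous_within at_within_Ici_at_right)
  next
    case False
    then have "isCont (\<lambda>r::real. r * ln r) r" using that by (intro continuous_intros) auto
    then show ?thesis by (rule continuous_at_imp_continuous_at_within)
  qed
  then show ?thesis by (auto simp: continuous_on_eq_continuous_within)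
qed

lemma abs_mult_diff_le:
  fixes x y x' y' :: real
  assumes "\<bar>x\<bar> \<le> M" "\<bar>y'\<bar> \<le> N" "\<bar>x - x'\<bar> \<le> P * d" "\<bar>y - y'\<bar> \<le> Q * d"
  shows "\<bar>x * y - x' * y'\<bar> \<le> (M * Q + N * P) * d"
proof -
  have "x * y - x' * y' = x * (y - y') + y' * (x - x')" by (simp add: algebra_simps)
  also have "\<bar>\<dots>\<bar> \<le> \<bar>x\<bar> * \<bar>y - y'\<bar> + \<bar>y'\<bar> * \<bar>x - x'\<bar>"
    by (metis abs_mult abs_triangle_ineq)
  also have "\<dots> \<le> M * (Q * d) + N * (P * d)"
    using assms by (intro add_mono mult_mono) auto
  finally show ?thesis by (simp add: algebra_simps)
qed

lemma filterlim_powr_at_right_0: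
  fixes b :: real
  assumes "b > 0"
  shows "LIM r at_right 0. r powr b :> at_right 0"
  using assms by real_asymp

lemma tendsto_powr_at_right_0: "b > 0 \<Longrightarrow> ((\<lambda>r. r powr b) \<longlongrightarrow> 0) (at_right 0)" for b :: real
  using filterlim_powr_at_right_0[of b] by (simp add: filterlim_at)

lemma tendsto_mult_ln_at_right_0: "((\<lambda>r::real. r * ln r) \<longlongrightarrow> 0) (at_right 0)"
  by real_asymp

section \<open>A lower bound for the square root of a solution\<close>

text \<open>If z were positive at b, then at the last time with z <= 0 it would vanish and be
  positive immediately afterwards, against its negative derivative there.\<close>

lemma nonpos_if_deriv_neg_at_zeros:
  fixes z z' :: "real \<Rightarrow> real"
  assumes "a \<le> b" "z a \<le> 0"
    and d: "\<And>t. t \<in> {a..b} \<Longrightarrow> DERIV z t :> z' t"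
    and neg: "\<And>t. t \<in> {a..b} \<Longrightarrow> z t = 0 \<Longrightarrow> z' t < 0"
  shows "z b \<le> 0"
proof (rule ccontr)
  assume "\<not> z b \<le> 0"
  have cont: "continuous_on {a..b} z"
    using d by (meson DERIV_isCont continuous_at_imp_continuous_on)
  define E where "E = {a..b} \<inter> z -` {..0}"
  have "closed E"
    unfolding E_def by (intro continuous_closed_preimage cont) auto
  moreover have "a \<in> E" using assms by (auto simp: E_def)
  moreover have bd: "bdd_above E" by (auto simp: E_def intro: bdd_aboveI)
  ultimately have "Sup E \<in> E" by (intro closed_contains_Sup) auto
  define s where "s = Sup E"
  have "s \<in> E" using \<open>Sup E \<in> E\<close> by (simp only: s_def)
  moreover from this have "s \<noteq> b" using \<open>\<not> z b \<le> 0\<close> by (auto simp: E_def)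
  ultimately have s: "a \<le> s" "s < b" "z s \<le> 0" by (auto simp: E_def)
  have pos: "z t > 0" if "s < t" "t \<le> b" for t
  proof (rule ccontr)
    assume "\<not> z t > 0"
    then have "t \<in> E" using that s by (auto simp: E_def)
    from cSup_upper[OF this bd] that show False by (simp add: s_def)
  qed
  have ev: "eventually (\<lambda>t. z t > 0) (at_right s)"
    using eventually_at_right_field[of "\<lambda>t. z t > 0" s] pos s by (auto intro!: exI[of _ b])
  have "isCont z s" using d[of s] s by (intro DERIV_isCont) auto
  then have "(z \<longlongrightarrow> z s) (at_right s)"
    by (simp add: isCont_def filterlim_at_split)
  then have "z s \<ge> 0"
    by (rule tendsto_lowerbound) (use ev in \<open>auto elim: eventually_mono\<close>)
  with s have "z s = 0" by simp
  with DERIV_neg_dec_right[OF d neg, of s] s obtain e where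
    e: "e > 0" "\<And>h. 0 < h \<Longrightarrow> h < e \<Longrightarrow> z (s + h) < z s" by auto
  define h where "h = min (e / 2) (b - s)"
  have "0 < h" "h < e" "s + h \<le> b" using e s by (auto simp: h_def)
  with e(2)[of h] pos[of "s + h"] \<open>z s = 0\<close> show False by auto
qed

text \<open>While \<open>j = 1 / (sqrt x * f)\<close> increases, \<open>f'\<close> dominates a multiple of \<open>j\<close> because the
  equation reads \<open>4 x\<^sup>2 f'' \<ge> 2 (n - 1) x powr (3/2) * j'\<close> where \<open>f' \<le> 0\<close>; for \<open>n > 4\<close> the
  function \<open>j\<close> cannot start to increase once it decreases.\<close>
lemma sqrt_profile_lower_bound:
  fixes f f1 f2 :: "real \<Rightarrow> real"
  assumes n: "n > 4" and l: "l \<ge> 0" and a: "0 < a" "a \<le> r" "r \<le> R"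
    and pos: "\<And>x. x \<in> {a..r} \<Longrightarrow> f x > 0"
    and f: "\<And>x. x \<in> {a..r} \<Longrightarrow> DERIV f x :> f1 x"
    and f1: "\<And>x. x \<in> {a..r} \<Longrightarrow> DERIV f1 x :> f2 x"
    and ode: "\<And>x. x \<in> {a..r} \<Longrightarrow> 4 * x^2 * f2 x =
      (n - 1) * f x - (n - 1) / f x - 2 * x * f1 x * (l * x + n - 1) / (f x)^2"
  shows "1 / (sqrt r * f r) \<le> 1 / (sqrt a * f a) + 2 * sqrt R / (n - 1) * \<bar>f1 a\<bar>"
proof -
  define j where "j x = 1 / (sqrt x * f x)" for x
  \<comment> \<open>Up to a positive factor z is the derivative of j: it is -2 sqrt x times the
    derivative of sqrt x * f. Where z > 0, also f' < 0.\<close>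
  define z where "z x = - (f x + 2 * x * f1 x)" for x
  define k where "k = (n - 1) / (2 * sqrt R)"
  have k: "k > 0" using n a by (auto simp: k_def)
  have dj: "DERIV j x :> z x / (2 * sqrt x * x * (f x)^2)" if "x \<in> {a..r}" for x
  proof -
    have x: "x > 0" "f x > 0" using that a pos by auto
    have sx: "sqrt x * sqrt x = x" using x by simp
    show ?thesis
      unfolding j_def z_def
      apply (rule derivative_eq_intros f that refl | (use x in simp; fail))+
      using x sx apply (simp add: field_simps power2_eq_square)
      done
  qed
  have dz: "DERIV z x :> - (3 * f1 x + 2 * x * f2 x)" if "x \<in> {a..r}" for x
    unfolding z_def by (rule derivative_eq_intros f f1 that refl)+ (simp add: algebra_simps)
  \<comment> \<open>At a zero of z one has 2 x f' = -f, and the equation becomes 2 x (3 f' + 2 x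
    f'') = (n-4) f + l x / f > 0. So z' < 0 at every zero, and z can only cross downwards.\<close>
  have persist: "z y \<le> 0" if "x \<in> {a..r}" "z x \<le> 0" "y \<in> {x..r}" for x y
  proof (rule nonpos_if_deriv_neg_at_zeros[of x y z "\<lambda>x. - (3 * f1 x + 2 * x * f2 x)"])
    fix t assume t: "t \<in> {x..y}" "z t = 0"
    with that have t': "t \<in> {a..r}" by auto
    then have tp: "t > 0" "f t > 0" using a pos by auto
    have f1t: "2 * t * f1 t = - f t" using t by (simp add: z_def)
    have "4 * t^2 * f2 t = (n - 1) * f t - (n - 1) / f t + f t * (l * t + n - 1) / (f t)^2"
      using ode[OF t'] f1t by simp
    also have "\<dots> = (n - 1) * f t + l * t / f t"
      using tp by (simp add: field_simps power2_eq_square)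
    finally have "2 * t * (3 * f1 t + 2 * t * f2 t) = (n - 4) * f t + l * t / f t"
      using f1t by (simp add: algebra_simps power2_eq_square)
    moreover have "(n - 4) * f t + l * t / f t > 0"
      using tp n l by (intro add_pos_nonneg) auto
    ultimately have "3 * f1 t + 2 * t * f2 t > 0"
      using tp by (metis mult_pos_pos zero_less_mult_pos zero_less_numeral)
    then show "- (3 * f1 t + 2 * t * f2 t) < 0" by simp
  qed (use that dz in auto)
  have bound: "j b \<le> j a + \<bar>f1 a\<bar> / k" if b: "b \<in> {a..r}" and zp: "\<And>x. x \<in> {a..<b} \<Longrightarrow> z x > 0" for b
  proof (cases "b = a")
    case True then show ?thesis using k by simp
  next
    case False
    then have ab: "a < b" using b by simp
    have cont: "continuous_on {a..r} z" "continuous_on {a..r} f1" "continuous_on {a..r} j"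
      using dz f1 dj by (meson DERIV_isCont continuous_at_imp_continuous_on)+
    have zb: "z b \<ge> 0"
    proof -
      have "(z \<longlongrightarrow> z b) (at_left b)"
        using cont(1) b ab by (meson DERIV_isCont dz isContD filterlim_at_split)
      moreover have "eventually (\<lambda>x. 0 \<le> z x) (at_left b)"
        unfolding eventually_at_left_field using zp ab by (intro exI[of _ a]) (auto intro: less_imp_le)
      ultimately show ?thesis by (rule tendsto_lowerbound) simp
    qed
    \<comment> \<open>While z > 0 the equation gives f'' >= (n-1)/(2 sqrt x) * j' >= k j', the
      constant k being the value of the factor at x = R. Since z b >= 0 forces f' <= 0 at b,
      monotonicity of f' - k j bounds j there by data at a.\<close>
    have "f1 a - k * j a \<le> f1 b - k * j b"
    proof (rule DERIV_nonneg_imp_increasing_open[of a b "\<lambda>x. f1 x - k * j x"])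
      show "a \<le> b" using ab by simp
      show "continuous_on {a..b} (\<lambda>x. f1 x - k * j x)"
        using b by (intro continuous_intros continuous_on_subset[OF cont(2)]
            continuous_on_subset[OF cont(3)]) auto
      fix x assume x: "a < x" "x < b"
      then have x': "x \<in> {a..r}" using b by auto
      then have xp: "x > 0" "f x > 0" "z x > 0" using a pos zp x by auto
      have f1n: "f1 x < 0"
      proof -
        have "2 * x * f1 x < 0" using xp(2,3) by (simp add: z_def)
        then show ?thesis using xp by (simp add: mult_less_0_iff)
      qed
      have "4 * x^2 * f2 x = (n - 1) * f x + (n - 1) * z x / (f x)^2 - 2 * x * f1 x * (l * x) / (f x)^2"
        unfolding ode[OF x'] using xp(1,2) by (simp add: z_def field_simps power2_eq_square)
      moreover have "(n - 1) * f x \<ge> 0" using n xp by simp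
      moreover have "- (2 * x * f1 x * (l * x) / (f x)^2) \<ge> 0"
      proof -
        have "x * f1 x * (l * x) \<le> 0"
          using xp f1n l by (simp add: mult_le_0_iff zero_le_mult_iff less_imp_le)
        then show ?thesis by (simp add: field_simps divide_nonpos_nonneg)
      qed
      ultimately have "(n - 1) * z x / (f x)^2 \<le> 4 * x^2 * f2 x" by linarith
      then have A: "(n - 1) * (z x / (4 * x^2 * (f x)^2)) \<le> f2 x"
        using xp by (simp add: field_simps)
      have sx: "sqrt x * sqrt x = x" using xp by simp
      have "sqrt x \<le> sqrt R" using x' a by auto
      then have "k * (z x / (2 * sqrt x * x * (f x)^2)) \<le> (n - 1) / (2 * sqrt x) * (z x / (2 * sqrt x * x * (f x)^2))"
        unfolding k_def using xp n by (intro mult_right_mono divide_left_mono) auto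
      also have "\<dots> = (n - 1) * (z x / (4 * x^2 * (f x)^2))"
        using xp sx by (simp add: field_simps power2_eq_square)
      finally have "0 \<le> f2 x - k * (z x / (2 * sqrt x * x * (f x)^2))" using A by linarith
      then show "\<exists>y. DERIV (\<lambda>x. f1 x - k * j x) x :> y \<and> 0 \<le> y"
        by (intro exI conjI) (rule derivative_eq_intros f1 dj x' refl | assumption | simp add: mult.commute)+
    qed
    moreover have "f1 b \<le> 0"
    proof -
      have "2 * b * f1 b \<le> 0" using zb pos[OF b] by (simp add: z_def)
      then show ?thesis using b a by (simp add: mult_le_0_iff)
    qed
    ultimately have "k * j b \<le> k * j a + \<bar>f1 a\<bar>" by linarith
    then show ?thesis using k by (simp add: field_simps)
  qed
  have "j r \<le> j a + \<bar>f1 a\<bar> / k"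
  proof (cases "\<forall>x\<in>{a..<r}. z x > 0")
    case True then show ?thesis using bound[of r] a by auto
  next
    case False
    \<comment> \<open>At the first point of [a, r] with z <= 0 the bound obtained so far still
      applies; from there on j decreases.\<close>
    define E where "E = {a..r} \<inter> z -` {..0}"
    have "continuous_on {a..r} z"
      using dz by (meson DERIV_isCont continuous_at_imp_continuous_on)
    then have "closed E"
      unfolding E_def by (intro continuous_closed_preimage) auto
    moreover have "E \<noteq> {}" using False by (force simp: E_def)
    moreover have bb: "bdd_below E" by (auto simp: E_def intro: bdd_belowI)
    ultimately have "Inf E \<in> E" by (intro closed_contains_Inf)
    define s where "s = Inf E"
    have s: "s \<in> {a..r}" "z s \<le> 0"
      using \<open>Inf E \<in> E\<close> by (auto simp: s_def E_def)
    have "z x > 0" if "x \<in> {a..<s}" for x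
    proof (rule ccontr)
      assume "\<not> z x > 0"
      then have "x \<in> E" using that s by (auto simp: E_def)
      from cInf_lower[OF this bb] that show False by (simp add: s_def)
    qed
    then have "j s \<le> j a + \<bar>f1 a\<bar> / k" using s by (intro bound) auto
    moreover have "j r \<le> j s"
    proof (rule DERIV_nonpos_imp_nonincreasing[of s r j])
      show "s \<le> r" using s by simp
      fix x assume x: "s \<le> x" "x \<le> r"
      then have x': "x \<in> {a..r}" using s by auto
      have "z x / (2 * sqrt x * x * (f x)^2) \<le> 0"
        using persist[of s x] s x a by (intro divide_nonpos_nonneg) auto
      then show "\<exists>y. DERIV j x :> y \<and> y \<le> 0" using dj[OF x'] by blast
    qed
    ultimately show ?thesis by linarith
  qed
  then show ?thesis by (simp add: j_def k_def mult.commute)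
qed

section \<open>Reduction to a first-order system\<close>

locale soliton =
  fixes n l a c0 c1 :: real
  assumes n: "n > 4" and l: "l \<ge> 0" and a_def: "a = sqrt n - 1" and c0: "c0 > 0"
begin

lemma n_eq: "n = (a + 1)^2"
  using n by (simp add: a_def)

text \<open>The form in which n > 4 is mostly used: r powr (a - 1) vanishes at 0 and increases, r
  powr (a - 2) is integrable at 0, and 2 a > a + 1, so the remainder of the expansion is smaller
  than the term carrying c1.\<close>

lemma a_gt_1: "a > 1"
proof -
  have "sqrt 4 < sqrt n" using n by (intro real_sqrt_less_mono)
  then show ?thesis by (simp add: a_def)
qed

text \<open>Here 2 A is the c2 of the theorem, and S(r)/r = A/r - B ln r is minus a primitive of (A
  + B r)/r^2. Moving it to the left side gives v = r^-a u' + S/(r u) with v' = -u' D/(r u^2), where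
  D = S + (l r + n - 1)/2. Accordingly \<open>\<theta>\<close> is r^(1-a) u' expressed through u and
  v.\<close>

definition A :: real where "A = (n - 1) * (a - 1) / 4"
definition B :: real where "B = a * l / 4"
definition S :: "real \<Rightarrow> real" where "S r = A - B * (r * ln r)"
definition D :: "real \<Rightarrow> real" where "D r = (n - 1) / 2 + A + l / 2 * r - B * (r * ln r)"
definition \<theta> :: "real \<Rightarrow> real \<Rightarrow> real \<Rightarrow> real" where "\<theta> r u v = r * v - S r / u"

text \<open>The equation satisfied by f = sqrt h. The derivatives are explicit functions, so that
  \<open>f1\<close> can be differentiated as a formula in u and v.\<close>

definition profile :: "(real \<Rightarrow> real) \<Rightarrow> (real \<Rightarrow> real) \<Rightarrow> (real \<Rightarrow> real) \<Rightarrow> real \<Rightarrow> bool" where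
  "profile f f1 f2 r \<longleftrightarrow> f r > 0 \<and> DERIV f r :> f1 r \<and> DERIV f1 r :> f2 r \<and>
     4 * r^2 * f2 r = (n - 1) * f r - (n - 1) / f r - 2 * r * f1 r * (l * r + n - 1) / (f r)^2"

definition flow :: "(real \<Rightarrow> real) \<Rightarrow> (real \<Rightarrow> real) \<Rightarrow> real \<Rightarrow> bool" where
  "flow u v r \<longleftrightarrow> u r > 0 \<and> DERIV u r :> r powr (a - 1) * \<theta> r (u r) (v r) \<and>
     DERIV v r :> - (r powr (a - 2) * (\<theta> r (u r) (v r) * D r / (u r)^2))"

lemma flow_imp_profile:
  assumes "r > 0" "flow u v r"
  defines "f \<equiv> \<lambda>r. r powr (- a / 2) * u r"
    and "f1 \<equiv> \<lambda>r. r powr (- a / 2) * (r powr (a - 1) * \<theta> r (u r) (v r) - a * u r / (2 * r))"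
  shows "profile f f1
    (\<lambda>r. ((n - 1) * f r - (n - 1) / f r - 2 * r * f1 r * (l * r + n - 1) / (f r)^2) / (4 * r^2)) r"
proof -
  define p where "p = r powr (- a / 2)"
  define q where "q = r powr (a - 1)"
  have u: "u r > 0" and du: "DERIV u r :> q * \<theta> r (u r) (v r)"
    and dv: "DERIV v r :> - (q / r * (\<theta> r (u r) (v r) * D r / (u r)^2))"
    using assms(1,2) by (auto simp: flow_def q_def powr_diff powr_numeral power2_eq_square)
  have p: "p > 0" and q: "q > 0" using \<open>r > 0\<close> by (auto simp: p_def q_def)
  \<comment> \<open>The relation p^2 q r = 1 between the two powers is all that is needed about
    them; with it the verification becomes an identity of rational functions.\<close>
  have "p^2 * q = r powr (-1)"
    by (simp add: p_def q_def power2_eq_square flip: powr_add)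
  then have pqr: "p^2 * (q * r) = 1" using \<open>r > 0\<close> by (simp add: powr_minus flip: mult.assoc)
  then have qr: "q * r = 1 / p^2" using p by (intro eq_divide_imp) (auto simp: mult.commute)
  have qrp: "q * r * p = 1 / p" unfolding qr using p by (simp add: power2_eq_square)
  have dp: "DERIV (\<lambda>r. r powr (- a / 2)) r :> - a / 2 * p / r"
    unfolding p_def by (rule DERIV_powr_const) fact
  have dq: "DERIV (\<lambda>r. r powr (a - 1)) r :> (a - 1) * q / r"
    unfolding q_def by (rule DERIV_powr_const) fact
  define x y w where "x = u r" and "y = \<theta> r (u r) (v r)" and "w = v r"
  have x: "x > 0" using u by (simp add: x_def)
  have dS: "DERIV S r :> - B * (ln r + 1)"
    unfolding S_def using \<open>r > 0\<close> by (auto intro!: derivative_eq_intros)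
  have dy: "DERIV (\<lambda>r. \<theta> r (u r) (v r)) r :>
      w - q * y * D r / x^2 + B * (ln r + 1) / x + S r * (q * y) / x^2"
    unfolding \<theta>_def
    apply (rule dS du dv derivative_eq_intros refl | (use u in simp; fail))+
    unfolding y_def[symmetric] unfolding x_def[symmetric] w_def[symmetric]
    using \<open>r > 0\<close> x by (simp add: field_simps power2_eq_square)
  have w: "w = (y + S r / x) / r"
    using \<open>r > 0\<close> by (simp add: y_def w_def x_def \<theta>_def)
  have df: "DERIV f r :> f1 r"
    using DERIV_mult[OF dp du] unfolding f_def f1_def p_def[symmetric] q_def[symmetric]
    by (rule DERIV_cong) (use \<open>r > 0\<close> in \<open>simp add: field_simps\<close>)
  have "DERIV f1 r :> - a / 2 * p / r * (q * y - a * x / (2 * r)) + p * ((a - 1) * q / r * y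
      + q * (w - q * y * D r / x^2 + B * (ln r + 1) / x + S r * (q * y) / x^2)
      - a * (q * y) / (2 * r) + a * x / (2 * r^2))" (is "DERIV f1 r :> ?d")
  proof -
    have "DERIV (\<lambda>r. a * u r / (2 * r)) r :> a * (q * y) / (2 * r) - a * x / (2 * r^2)"
      unfolding x_def y_def
      by (rule DERIV_cong, (rule du derivative_intros | (use \<open>r > 0\<close> in simp; fail))+)
        (use \<open>r > 0\<close> in \<open>simp add: field_simps power2_eq_square\<close>)
    from DERIV_mult[OF dp DERIV_diff[OF DERIV_mult[OF dq dy] this]] show ?thesis
      unfolding f1_def p_def[symmetric] q_def[symmetric] y_def[symmetric]
      unfolding x_def[symmetric]
      by (rule DERIV_cong) (simp add: algebra_simps)
  qed
  moreover have "?d = ((n - 1) * f r - (n - 1) / f r - 2 * r * f1 r * (l * r + n - 1) / (f r)^2) / (4 * r^2)"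
  proof -
    \<comment> \<open>The logarithms disappear at the next step: S + B r (ln r + 1) = A + B r, and S
      - D = -(n - 1 + l r)/2.\<close>
    have "?d = p * (((a + 1)^2 - 1) / 4 * x / r^2 + q * (S r / x + B * r * (ln r + 1) / x) / r
        + q^2 * y * (S r - D r) / x^2)"
      unfolding w using \<open>r > 0\<close> x by (simp add: field_simps power2_eq_square)
    also have "\<dots> = p * ((n - 1) / 4 * x / r^2 + q * (A + B * r) / x / r
        - q^2 * y * (n - 1 + l * r) / (2 * x^2))"
      unfolding n_eq[symmetric] S_def D_def using \<open>r > 0\<close> x by (simp add: field_simps)
    \<comment> \<open>Here 4 (A + B r) = -(n-1) + a (l r + n - 1): the first part is the term
      -(n-1)/f, the second comes from the share -a u/(2 r) in f'.\<close>
    also have "\<dots> = ((n - 1) * (p * x) - (n - 1) * (q * r * p) / x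
        - 2 * r * (p * (q * y - a * x / (2 * r))) * (l * r + n - 1) * (q * r) / x^2) / (4 * r^2)"
      unfolding A_def B_def using \<open>r > 0\<close> x by (simp add: field_simps power2_eq_square)
    also have "\<dots> = ((n - 1) * (p * x) - (n - 1) / (p * x)
        - 2 * r * (p * (q * y - a * x / (2 * r))) * (l * r + n - 1) / (p * x)^2) / (4 * r^2)"
      unfolding qrp unfolding qr using p x by (simp add: power_mult_distrib)
    finally show ?thesis
      unfolding f_def f1_def p_def[symmetric] q_def[symmetric] y_def[symmetric]
      unfolding x_def[symmetric] .
  qed
  moreover have "f r > 0" using u \<open>r > 0\<close> by (simp add: f_def)
  ultimately show ?thesis using df \<open>r > 0\<close> by (simp add: profile_def)
qed

text \<open>Inverse of the previous passage: v is obtained by solving r^-a u' = v - S/(r u), where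
  u' = r^(a/2) (f' + a f/(2 r)).\<close>

lemma profile_imp_flow:
  assumes "r > 0" "profile f f1 f2 r"
  defines "u \<equiv> \<lambda>r. r powr (a / 2) * f r"
  defines "v \<equiv> \<lambda>r. (f1 r + a * f r / (2 * r)) / r powr (a / 2) + S r / (r * u r)"
  shows "flow u v r"
proof -
  define p where "p = r powr (a / 2)"
  have f: "f r > 0" and df: "DERIV f r :> f1 r" and df1: "DERIV f1 r :> f2 r"
    and ode: "4 * r^2 * f2 r = (n - 1) * f r - (n - 1) / f r - 2 * r * f1 r * (l * r + n - 1) / (f r)^2"
    using assms(2) by (auto simp: profile_def)
  have p: "p > 0" using \<open>r > 0\<close> by (simp add: p_def)
  have dp: "DERIV (\<lambda>r. r powr (a / 2)) r :> a / 2 * p / r"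
    unfolding p_def by (rule DERIV_powr_const) fact
  have pp: "p * p = r powr a" by (simp add: p_def flip: powr_add)
  define e where "e = f1 r + a * f r / (2 * r)"
  have th: "\<theta> r (u r) (v r) = r * e / p"
    using \<open>r > 0\<close> p f by (simp add: \<theta>_def v_def u_def e_def p_def field_simps)
  have du: "DERIV u r :> p * e"
    using DERIV_mult[OF dp df] unfolding u_def e_def p_def[symmetric]
    by (rule DERIV_cong) (use \<open>r > 0\<close> in \<open>simp add: field_simps\<close>)
  have dS: "DERIV S r :> - B * (ln r + 1)"
    unfolding S_def using \<open>r > 0\<close> by (auto intro!: derivative_eq_intros)
  have "DERIV v r :> (f2 r - ((a + 1)^2 - 1) / 4 * f r / r^2 - B * (ln r + 1) / (r * f r)
      - S r / (r^2 * f r) - S r * e / (r * (f r)^2)) / p" (is "DERIV v r :> ?d")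
  proof -
    have "DERIV (\<lambda>r. f1 r + a * f r / (2 * r)) r :>
        f2 r + a * f1 r / (2 * r) - a * f r / (2 * r^2)"
      by (rule DERIV_cong, (rule df df1 derivative_intros | (use \<open>r > 0\<close> in simp; fail))+)
        (use \<open>r > 0\<close> in \<open>simp add: field_simps power2_eq_square\<close>)
    from DERIV_divide[OF this dp]
    have "DERIV (\<lambda>r. (f1 r + a * f r / (2 * r)) / r powr (a / 2)) r :>
        (f2 r - ((a + 1)^2 - 1) / 4 * f r / r^2) / p"
      unfolding p_def[symmetric]
      by (rule DERIV_cong) (use \<open>r > 0\<close> p in \<open>auto simp: field_simps power2_eq_square p_def\<close>)
    moreover have "DERIV (\<lambda>r. r * u r) r :> u r + r * (p * e)"
      by (rule DERIV_cong, (rule du derivative_intros)+) simp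
    from DERIV_divide[OF dS this]
    have "DERIV (\<lambda>r. S r / (r * u r)) r :>
        (- B * (ln r + 1) / (r * f r) - S r / (r^2 * f r) - S r * e / (r * (f r)^2)) / p"
      unfolding u_def p_def[symmetric]
      by (rule DERIV_cong) (use \<open>r > 0\<close> p f in \<open>auto simp: field_simps power2_eq_square p_def\<close>)
    ultimately show ?thesis
      unfolding v_def by (rule DERIV_cong[OF DERIV_add]) (simp add: diff_divide_distrib)
  qed
  moreover have "?d = - (e * D r / (r * (f r)^2)) / p"
  proof -
    have "f2 r = ((n - 1) * f r - (n - 1) / f r - 2 * r * f1 r * (l * r + n - 1) / (f r)^2) / (4 * r^2)"
      using ode \<open>r > 0\<close> by (simp add: field_simps)
    moreover have "f1 r = e - a * f r / (2 * r)" by (simp add: e_def)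
    ultimately have "f2 r = ((n - 1) * f r - (n - 1) / f r
        - 2 * r * (e - a * f r / (2 * r)) * (l * r + n - 1) / (f r)^2) / (4 * r^2)" by simp
    also have "\<dots> = ((a + 1)^2 - 1) / 4 * f r / r^2 + (A + B * r) / (r^2 * f r)
        - e * (l * r + n - 1) / (2 * r * (f r)^2)"
      unfolding n_eq[symmetric] A_def B_def
      using \<open>r > 0\<close> f by (simp add: field_simps power2_eq_square)
    finally have f2_eq: "f2 r = ((a + 1)^2 - 1) / 4 * f r / r^2 + (A + B * r) / (r^2 * f r)
        - e * (l * r + n - 1) / (2 * r * (f r)^2)" .
    show ?thesis
      unfolding f2_eq S_def D_def using \<open>r > 0\<close> f p by (simp add: field_simps power2_eq_square)
  qed
  ultimately have dv: "DERIV v r :> - (e * D r / (r * (f r)^2)) / p" by simp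
  have "r powr (a - 1) * (r * e / p) = p * e"
    using \<open>r > 0\<close> p pp by (simp add: powr_diff field_simps flip: pp)
  moreover have "r powr (a - 2) * (r * e / p * D r / (u r)^2) = (e * D r / (r * (f r)^2)) / p"
    using \<open>r > 0\<close> p f
    by (simp add: powr_diff powr_numeral u_def p_def[symmetric] field_simps power2_eq_square flip: pp)
  moreover have "u r > 0" using \<open>r > 0\<close> f by (simp add: u_def)
  ultimately show ?thesis using du dv by (simp add: flow_def th)
qed

section \<open>Passing between h and its square root\<close>

definition h_ode :: "(real \<Rightarrow> real) \<Rightarrow> (real \<Rightarrow> real) \<Rightarrow> (real \<Rightarrow> real) \<Rightarrow> real \<Rightarrow> bool" where
  "h_ode h h1 h2 r \<longleftrightarrow> h r > 0 \<and> DERIV h r :> h1 r \<and> DERIV h1 r :> h2 r \<and>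
     2 * r^2 * h r * h2 r = (n - 1) * h r * (h r - 1) + r * h1 r * (r * h1 r - l * r - (n - 1))"

text \<open>For h = f^2 the part 2 f'^2 of h'' contributes 4 r^2 f^2 f'^2 to the left side, which is
  exactly (r h')^2 on the right. This cancellation is why the equation for f has no quadratic term
  in f'.\<close>

lemma profile_imp_h_ode:
  assumes "r > 0" "profile f f1 f2 r"
  shows "h_ode (\<lambda>r. (f r)^2) (\<lambda>r. 2 * f r * f1 r) (\<lambda>r. 2 * (f1 r)^2 + 2 * f r * f2 r) r"
proof -
  have f: "f r > 0" and df: "DERIV f r :> f1 r" and df1: "DERIV f1 r :> f2 r"
    and ode: "4 * r^2 * f2 r = (n - 1) * f r - (n - 1) / f r - 2 * r * f1 r * (l * r + n - 1) / (f r)^2"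
    using assms(2) by (auto simp: profile_def)
  have "2 * r^2 * (f r)^2 * (2 * (f1 r)^2 + 2 * f r * f2 r) =
    4 * r^2 * (f r)^2 * (f1 r)^2 + (f r)^3 * (4 * r^2 * f2 r)"
    by (simp add: algebra_simps power2_eq_square power3_eq_cube)
  also have "\<dots> = (n - 1) * (f r)^2 * ((f r)^2 - 1)
      + r * (2 * f r * f1 r) * (r * (2 * f r * f1 r) - l * r - (n - 1))"
    unfolding ode using f by (simp add: field_simps power2_eq_square power3_eq_cube)
  moreover have "DERIV (\<lambda>r. (f r)^2) r :> 2 * f r * f1 r"
    by (auto intro!: derivative_eq_intros df)
  moreover have "DERIV (\<lambda>r. 2 * f r * f1 r) r :> 2 * (f1 r)^2 + 2 * f r * f2 r"
    by (rule df df1 derivative_eq_intros refl)+ (simp add: power2_eq_square)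
  ultimately show ?thesis using f by (simp add: h_ode_def)
qed

lemma h_ode_imp_profile:
  assumes "r > 0" "h_ode h h1 h2 r"
  defines "f \<equiv> \<lambda>r. sqrt (h r)"
  defines "f1 \<equiv> \<lambda>r. h1 r / (2 * f r)"
  shows "profile f f1 (\<lambda>r. (h2 r / 2 - (f1 r)^2) / f r) r"
proof -
  have h: "h r > 0" and dh: "DERIV h r :> h1 r" and dh1: "DERIV h1 r :> h2 r"
    and ode: "2 * r^2 * h r * h2 r = (n - 1) * h r * (h r - 1) + r * h1 r * (r * h1 r - l * r - (n - 1))"
    using assms(2) by (auto simp: h_ode_def)
  have f: "f r > 0" "(f r)^2 = h r" "h1 r = 2 * f r * f1 r" using h by (auto simp: f_def f1_def)
  have df: "DERIV f r :> f1 r"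
    unfolding f_def f1_def
    using DERIV_chain2[OF DERIV_real_sqrt[OF h] dh] by (rule DERIV_cong) (simp add: field_simps)
  have df1: "DERIV f1 r :> (h2 r / 2 - (f1 r)^2) / f r"
  proof -
    from DERIV_divide[OF dh1 DERIV_cmult[OF df, of 2]]
    have "DERIV (\<lambda>r. h1 r / (2 * f r)) r :> (h2 r * (2 * f r) - h1 r * (2 * f1 r)) / ((2 * f r) * (2 * f r))"
      using f(1) by simp
    moreover have "(h2 r * (2 * f r) - h1 r * (2 * f1 r)) / ((2 * f r) * (2 * f r)) = (h2 r / 2 - (f1 r)^2) / f r"
      unfolding f(3) using f(1) by (simp add: field_simps power2_eq_square)
    ultimately show ?thesis by (simp add: f1_def)
  qed
  define g2 where "g2 = (h2 r / 2 - (f1 r)^2) / f r"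
  have h2: "h2 r = 2 * (f1 r)^2 + 2 * f r * g2" using f(1) by (simp add: g2_def)
  have "(f r)^3 * (4 * r^2 * g2) = (n - 1) * (f r)^2 * ((f r)^2 - 1)
      + r * (2 * f r * f1 r) * (- l * r - (n - 1))"
    using ode[unfolded f(2)[symmetric] h2 f(3)]
    by (simp add: algebra_simps power2_eq_square power3_eq_cube)
  also have "\<dots> = (f r)^3 *
      ((n - 1) * f r - (n - 1) / f r - 2 * r * f1 r * (l * r + n - 1) / (f r)^2)"
    using f(1) by (simp add: field_simps power2_eq_square power3_eq_cube)
  finally have "4 * r^2 * g2 = (n - 1) * f r - (n - 1) / f r - 2 * r * f1 r * (l * r + n - 1) / (f r)^2"
    using f(1) by simp
  with f(1) df df1 show ?thesis by (simp add: profile_def g2_def)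
qed

end

section \<open>Lipschitz bounds and uniqueness for the system\<close>

context soliton
begin

lemma continuous_on_S: "continuous_on {0..} S"
  unfolding S_def by (intro continuous_intros continuous_on_mult_ln)

lemma continuous_on_D: "continuous_on {0..} D"
  unfolding D_def by (intro continuous_intros continuous_on_mult_ln)

text \<open>The flow in the time \<open>t = r powr (a - 1)\<close>, which removes the singular factor
  \<open>r powr (a - 2)\<close>; at \<open>t = 0\<close> the right-hand side is evaluated at \<open>0 powr _ = 0\<close>.\<close>
definition rad :: "real \<Rightarrow> real" where "rad t = t powr (1 / (a - 1))"
definition F :: "real \<Rightarrow> real \<times> real \<Rightarrow> real \<times> real" where
  "F t x = (rad t * \<theta> (rad t) (fst x) (snd x) / (a - 1),
     - (\<theta> (rad t) (fst x) (snd x) * D (rad t) / (fst x)^2) / (a - 1))"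

lemma continuous_on_rad: "continuous_on {0..} rad"
  unfolding rad_def using a_gt_1 by (intro continuous_on_powr' continuous_intros) auto

lemma rad_nonneg: "rad t \<ge> 0" by (simp add: rad_def)

lemma rad_powr: "r > 0 \<Longrightarrow> rad (r powr (a - 1)) = r"
  using a_gt_1 by (simp add: rad_def powr_powr)

lemma continuous_on_F:
  assumes "continuous_on X g" "\<And>x. x \<in> X \<Longrightarrow> fst (g x) > 0"
    "continuous_on X \<tau>" "\<And>x. x \<in> X \<Longrightarrow> \<tau> x \<ge> 0"
  shows "continuous_on X (\<lambda>x. F (\<tau> x) (g x))"
proof -
  have r: "continuous_on X (\<lambda>x. rad (\<tau> x))"
    using assms by (intro continuous_on_compose2[OF continuous_on_rad]) auto
  have "continuous_on X (\<lambda>x. S (rad (\<tau> x)))" "continuous_on X (\<lambda>x. D (rad (\<tau> x)))"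
    using rad_nonneg
    by (auto intro!: continuous_on_compose2[OF continuous_on_S r] continuous_on_compose2[OF continuous_on_D r])
  with r assms a_gt_1 show ?thesis
    unfolding F_def \<theta>_def by (intro continuous_intros) (force simp: less_imp_neq[symmetric])+
qed

lemma bounded_coeffs:
  assumes "T \<ge> 0"
  obtains b where "b \<ge> 1" "\<And>t. t \<in> {0..T} \<Longrightarrow> rad t \<le> b"
    "\<And>t. t \<in> {0..T} \<Longrightarrow> \<bar>S (rad t)\<bar> \<le> b" "\<And>t. t \<in> {0..T} \<Longrightarrow> \<bar>D (rad t)\<bar> \<le> b"
proof -
  have r: "continuous_on {0..T} rad"
    by (rule continuous_on_subset[OF continuous_on_rad]) auto
  have "continuous_on {0..T} (\<lambda>t. rad t + \<bar>S (rad t)\<bar> + \<bar>D (rad t)\<bar>)"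
    using rad_nonneg
    by (auto intro!: continuous_intros r continuous_on_compose2[OF continuous_on_S r] continuous_on_compose2[OF continuous_on_D r])
  then obtain t0 where "\<And>t. t \<in> {0..T} \<Longrightarrow> rad t + \<bar>S (rad t)\<bar> + \<bar>D (rad t)\<bar>
      \<le> rad t0 + \<bar>S (rad t0)\<bar> + \<bar>D (rad t0)\<bar>"
    using continuous_attains_sup[of "{0..T}" "\<lambda>t. rad t + \<bar>S (rad t)\<bar> + \<bar>D (rad t)\<bar>"] assms by force
  then show thesis
    using rad_nonneg abs_ge_zero
    by (intro that[of "max 1 (rad t0 + \<bar>S (rad t0)\<bar> + \<bar>D (rad t0)\<bar>)"]) (smt (verit))+
qed

text \<open>\<open>F\<close> is built from v and 1/u with coefficients bounded on [0, T]. For u >= m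
  the function 1/u is bounded by 1/m and Lipschitz with constant 1/m^2, so an upper bound on u is
  never involved.\<close>

lemma F_lipschitz:
  assumes "T \<ge> 0" "m > 0"
  obtains L where "L > 0" "\<And>t x y. \<lbrakk>t \<in> {0..T}; fst x \<ge> m; fst y \<ge> m; \<bar>snd x\<bar> \<le> M; \<bar>snd y\<bar> \<le> M\<rbrakk>
    \<Longrightarrow> norm (F t x - F t y) \<le> L * norm (x - y)"
proof -
  obtain b where b: "b \<ge> 1" "\<And>t. t \<in> {0..T} \<Longrightarrow> rad t \<le> b"
    "\<And>t. t \<in> {0..T} \<Longrightarrow> \<bar>S (rad t)\<bar> \<le> b" "\<And>t. t \<in> {0..T} \<Longrightarrow> \<bar>D (rad t)\<bar> \<le> b"
    using bounded_coeffs[OF assms(1)] by blast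
  \<comment> \<open>K1 is a Lipschitz constant for \<open>\<theta>\<close> and B1 a bound for it; K2
    and K3 are Lipschitz constants for 1/u^2 and \<open>\<theta>\<close>/u^2.\<close>
  define K1 where "K1 = b + b / m^2"
  define B1 where "B1 = b * \<bar>M\<bar> + b / m"
  define K2 where "K2 = 1 / m * (1 / m^2) + 1 / m * (1 / m^2)"
  define K3 where "K3 = B1 * K2 + 1 / m^2 * K1"
  define L where "L = (b * K1 + b * K3) / (a - 1)"
  have K1: "K1 > 0" using b(1) by (simp add: K1_def add_pos_nonneg)
  have B1: "B1 \<ge> 0" using b(1) assms by (simp add: B1_def)
  have K2: "K2 > 0" using assms by (simp add: K2_def add_pos_pos)
  have K3: "K3 \<ge> 0" using K1 K2 B1 by (simp add: K3_def)
  have a1: "a - 1 > 0" using a_gt_1 by simp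
  have "L > 0" using K1 K3 b(1) a1 by (simp add: L_def add_pos_nonneg)
  moreover have "norm (F t x - F t y) \<le> L * norm (x - y)"
    if t: "t \<in> {0..T}" and x: "fst x \<ge> m" "\<bar>snd x\<bar> \<le> M" and y: "fst y \<ge> m" "\<bar>snd y\<bar> \<le> M" for t x y
  proof -
    define d where "d = norm (x - y)"
    define r where "r = rad t"
    have r: "0 \<le> r" "r \<le> b" "\<bar>S r\<bar> \<le> b" "\<bar>D r\<bar> \<le> b"
      using b t rad_nonneg by (auto simp: r_def)
    have d: "\<bar>fst x - fst y\<bar> \<le> d" "\<bar>snd x - snd y\<bar> \<le> d"
      using norm_fst_le[of "fst x - fst y" "snd x - snd y"] norm_snd_le[of "snd x - snd y" "fst x - fst y"]
      by (auto simp: d_def minus_prod_def)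
    have i: "\<bar>1 / fst x\<bar> \<le> 1 / m" "\<bar>1 / fst y\<bar> \<le> 1 / m"
      using x y assms by (auto simp: field_simps)
    have id: "\<bar>1 / fst x - 1 / fst y\<bar> \<le> 1 / m^2 * d"
    proof -
      have "\<bar>1 / fst x - 1 / fst y\<bar> = \<bar>fst x - fst y\<bar> * (1 / fst x * (1 / fst y))"
        using x y assms by (auto simp: field_simps abs_if)
      also have "\<dots> \<le> d * (1 / m * (1 / m))"
        using i d x y assms by (intro mult_mono) auto
      finally show ?thesis by (simp add: power2_eq_square)
    qed
    have M: "M \<ge> 0" using x(2) by linarith
    have th: "\<bar>\<theta> r (fst x) (snd x)\<bar> \<le> B1"
    proof -
      have "\<bar>\<theta> r (fst x) (snd x)\<bar> \<le> \<bar>r\<bar> * \<bar>snd x\<bar> + \<bar>S r\<bar> * \<bar>1 / fst x\<bar>"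
        unfolding \<theta>_def by (metis abs_mult abs_triangle_ineq4 times_divide_eq_right mult.right_neutral)
      also have "\<dots> \<le> b * M + b * (1 / m)"
        using r x i b(1) M by (intro add_mono mult_mono) auto
      finally show ?thesis using M by (simp add: B1_def)
    qed
    have thd: "\<bar>\<theta> r (fst x) (snd x) - \<theta> r (fst y) (snd y)\<bar> \<le> K1 * d"
    proof -
      have "\<theta> r (fst x) (snd x) - \<theta> r (fst y) (snd y)
          = r * (snd x - snd y) - S r * (1 / fst x - 1 / fst y)"
        by (simp add: \<theta>_def algebra_simps)
      also have "\<bar>\<dots>\<bar> \<le> \<bar>r\<bar> * \<bar>snd x - snd y\<bar> + \<bar>S r\<bar> * \<bar>1 / fst x - 1 / fst y\<bar>"
        by (metis abs_mult abs_triangle_ineq4)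
      also have "\<dots> \<le> b * d + b * (1 / m^2 * d)"
        using r d id b(1) by (intro add_mono mult_mono) auto
      finally show ?thesis by (simp add: K1_def algebra_simps)
    qed
    have "\<bar>1 / fst x * (1 / fst x) - 1 / fst y * (1 / fst y)\<bar> \<le> K2 * d"
      unfolding K2_def by (rule abs_mult_diff_le[OF i id id])
    then have "\<bar>\<theta> r (fst x) (snd x) * (1 / fst x * (1 / fst x)) - \<theta> r (fst y) (snd y) * (1 / fst y * (1 / fst y))\<bar> \<le> K3 * d"
      unfolding K3_def
    proof (intro abs_mult_diff_le[OF th _ thd])
      have "\<bar>1 / fst y\<bar> * \<bar>1 / fst y\<bar> \<le> 1 / m * (1 / m)"
        using i(2) assms by (intro mult_mono) auto
      then show "\<bar>1 / fst y * (1 / fst y)\<bar> \<le> 1 / m\<^sup>2" by (simp add: abs_mult power2_eq_square)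
    qed
    then have q: "\<bar>\<theta> r (fst x) (snd x) / (fst x)^2 - \<theta> r (fst y) (snd y) / (fst y)^2\<bar> \<le> K3 * d"
      by (simp add: power2_eq_square)
    define p q where "p = r * (\<theta> r (fst x) (snd x) - \<theta> r (fst y) (snd y)) / (a - 1)"
      and "q = D r * (\<theta> r (fst x) (snd x) / (fst x)^2 - \<theta> r (fst y) (snd y) / (fst y)^2) / (a - 1)"
    have "F t x - F t y = (p, - q)"
      by (simp add: F_def r_def[symmetric] p_def q_def algebra_simps diff_divide_distrib)
    then have "norm (F t x - F t y) \<le> \<bar>p\<bar> + \<bar>q\<bar>"
      using norm_Pair_le[of p "- q"] by simp
    also have "\<dots> = (\<bar>r\<bar> * \<bar>\<theta> r (fst x) (snd x) - \<theta> r (fst y) (snd y)\<bar>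
      + \<bar>D r\<bar> * \<bar>\<theta> r (fst x) (snd x) / (fst x)^2 - \<theta> r (fst y) (snd y) / (fst y)^2\<bar>) / (a - 1)"
      using a1 by (simp add: p_def q_def abs_mult add_divide_distrib)
    also have "\<dots> \<le> (b * (K1 * d) + b * (K3 * d)) / (a - 1)"
      using a1 r thd q b(1) by (intro divide_right_mono add_mono mult_mono) auto
    also have "\<dots> = L * d" by (simp add: L_def field_simps)
    finally show ?thesis by (simp add: d_def)
  qed
  ultimately show thesis using that by blast
qed

text \<open>On the compact interval [0, s] both first components have a positive minimum and both
  second components are bounded, so the two trajectories lie in one region where \<open>F\<close> is
  Lipschitz.\<close>

lemma ode_sol_F_unique:
  assumes X: "ode_sol F x0 T X" "\<And>t. t \<in> {0..<T} \<Longrightarrow> fst (X t) > 0"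
    and Y: "ode_sol F x0 T Y" "\<And>t. t \<in> {0..<T} \<Longrightarrow> fst (Y t) > 0"
    and s: "s \<in> {0..<T}"
  shows "X s = Y s"
proof -
  have cont: "continuous_on {0..s} X" "continuous_on {0..s} Y"
    using X(1) Y(1) s by (auto simp: ode_sol_def elim: continuous_on_subset)
  have s0: "{0..s} \<noteq> {}" using s by simp
  obtain t1 where t1: "t1 \<in> {0..s}" "\<And>t. t \<in> {0..s} \<Longrightarrow> min (fst (X t1)) (fst (Y t1)) \<le> min (fst (X t)) (fst (Y t))"
    using continuous_attains_inf[OF compact_Icc s0, of "\<lambda>t. min (fst (X t)) (fst (Y t))"]
      continuous_on_min[OF continuous_on_fst[OF cont(1)] continuous_on_fst[OF cont(2)]] by blast
  obtain t2 where t2: "t2 \<in> {0..s}" "\<And>t. t \<in> {0..s} \<Longrightarrow> max \<bar>snd (X t)\<bar> \<bar>snd (Y t)\<bar> \<le> max \<bar>snd (X t2)\<bar> \<bar>snd (Y t2)\<bar>"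
    using continuous_attains_sup[OF compact_Icc s0, of "\<lambda>t. max \<bar>snd (X t)\<bar> \<bar>snd (Y t)\<bar>"]
      continuous_on_max[OF continuous_on_rabs[OF continuous_on_snd[OF cont(1)]]
        continuous_on_rabs[OF continuous_on_snd[OF cont(2)]]] by blast
  define m where "m = min (fst (X t1)) (fst (Y t1))"
  have "m > 0" using t1(1) X(2) Y(2) s by (auto simp: m_def)
  moreover have "s \<ge> 0" using s by simp
  ultimately obtain L where L: "\<And>t x y. \<lbrakk>t \<in> {0..s}; fst x \<ge> m; fst y \<ge> m;
      \<bar>snd x\<bar> \<le> max \<bar>snd (X t2)\<bar> \<bar>snd (Y t2)\<bar>; \<bar>snd y\<bar> \<le> max \<bar>snd (X t2)\<bar> \<bar>snd (Y t2)\<bar>\<rbrakk>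
    \<Longrightarrow> norm (F t x - F t y) \<le> L * norm (x - y)"
    using F_lipschitz by metis
  show ?thesis
  proof (rule ode_unique[OF cont, where G = F and L = L])
    fix t assume t: "t \<in> {0<..<s}"
    then have t': "t \<in> {0..s}" by auto
    show "norm (F t (X t) - F t (Y t)) \<le> L * norm (X t - Y t)"
      using t1(2)[OF t'] t2(2)[OF t'] by (intro L t') (auto simp: m_def)
  qed (use X(1) Y(1) s in \<open>auto simp: ode_sol_def\<close>)
qed

end

section \<open>Global existence\<close>

context soliton
begin

text \<open>The second component makes 2 u v start at c1. Since (r^a h)' contains 2 r^a u v, this
  yields the coefficient c1/(a+1) of r^(a+1).\<close>

definition x0 :: "real \<times> real" where "x0 = (sqrt c0, c1 / (2 * sqrt c0))"

text \<open>Composing \<open>F\<close> with the clamping of both components into the region u >= m,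
  |v| <= M leaves it unchanged there and makes it globally Lipschitz, because clamping is itself
  Lipschitz.\<close>

lemma F_truncation:
  assumes "T \<ge> 0" "m > 0" "M \<ge> 0"
  obtains G :: "real \<Rightarrow> real \<times> real \<Rightarrow> real \<times> real" and L where "L > 0"
    "continuous_on ({0..T} \<times> UNIV) (\<lambda>(t, x). G t x)"
    "\<And>t x y. t \<in> {0..T} \<Longrightarrow> norm (G t x - G t y) \<le> L * norm (x - y)"
    "\<And>t x. fst x \<ge> m \<Longrightarrow> \<bar>snd x\<bar> \<le> M \<Longrightarrow> G t x = F t x"
proof -
  obtain L where L: "L > 0" "\<And>t x y. \<lbrakk>t \<in> {0..T}; fst x \<ge> m; fst y \<ge> m; \<bar>snd x\<bar> \<le> M; \<bar>snd y\<bar> \<le> M\<rbrakk>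
    \<Longrightarrow> norm (F t x - F t y) \<le> L * norm (x - y)"
    using F_lipschitz[OF assms(1,2)] by blast
  define tr :: "real \<times> real \<Rightarrow> real \<times> real" where "tr x = (max m (fst x), max (- M) (min M (snd x)))" for x
  have tr: "norm (tr x - tr y) \<le> 2 * norm (x - y)" for x y
  proof -
    have "norm (tr x - tr y) \<le> \<bar>max m (fst x) - max m (fst y)\<bar>
        + \<bar>max (- M) (min M (snd x)) - max (- M) (min M (snd y))\<bar>"
      unfolding tr_def diff_Pair by (rule order_trans[OF norm_Pair_le]) simp
    also have "\<dots> \<le> \<bar>fst x - fst y\<bar> + \<bar>snd x - snd y\<bar>"
      by (intro add_mono) (auto simp: max_def min_def abs_if)
    also have "\<dots> \<le> 2 * norm (x - y)"
      using norm_fst_le[of "fst x - fst y" "snd x - snd y"] norm_snd_le[of "snd x - snd y" "fst x - fst y"]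
      by (auto simp: minus_prod_def)
    finally show ?thesis .
  qed
  have trm: "fst (tr x) \<ge> m" "\<bar>snd (tr x)\<bar> \<le> M" for x using assms by (auto simp: tr_def)
  show thesis
  proof (rule that[of "2 * L" "\<lambda>t x. F t (tr x)"])
    show "2 * L > 0" using L by simp
    have "continuous_on ({0..T} \<times> UNIV) (\<lambda>z. F (fst z) (tr (snd z)))"
    proof (rule continuous_on_F)
      show "continuous_on ({0..T} \<times> UNIV) (\<lambda>z. tr (snd z))"
        unfolding tr_def by (intro continuous_intros)
      show "fst (tr (snd z)) > 0" for z :: "real \<times> real \<times> real"
        using trm(1)[of "snd z"] assms by simp
    qed (auto intro!: continuous_intros)
    then show "continuous_on ({0..T} \<times> UNIV) (\<lambda>(t, x). F t (tr x))"
      by (simp add: case_prod_beta)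
    show "norm (F t (tr x) - F t (tr y)) \<le> 2 * L * norm (x - y)" if "t \<in> {0..T}" for t x y
    proof -
      have "norm (F t (tr x) - F t (tr y)) \<le> L * norm (tr x - tr y)" by (intro L that trm)
      also have "\<dots> \<le> L * (2 * norm (x - y))" using L by (intro mult_left_mono tr) auto
      finally show ?thesis by simp
    qed
    show "F t (tr x) = F t x" if "fst x \<ge> m" "\<bar>snd x\<bar> \<le> M" for t x
    proof -
      have "tr x = x" using that by (intro prod_eqI) (auto simp: tr_def)
      then show ?thesis by simp
    qed
  qed
qed

text \<open>Provides a radius r0 > 0 with known data, from which the lower bound for f can be
  started; at r = 0 itself f and f' are singular.\<close>

lemma local_solution:
  obtains t0 X where "t0 > 0" "ode_sol F x0 t0 X" "\<And>t. t \<in> {0..<t0} \<Longrightarrow> fst (X t) > sqrt c0 / 2"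
proof -
  define M where "M = \<bar>c1 / (2 * sqrt c0)\<bar> + 1"
  have d: "sqrt c0 / 2 > 0" using c0 by simp
  have M: "M \<ge> 0" by (simp add: M_def)
  obtain G L where G: "L > 0" "continuous_on ({0..1} \<times> UNIV) (\<lambda>(t, x). G t x)"
    "\<And>t x y. t \<in> {0..1} \<Longrightarrow> norm (G t x - G t y) \<le> L * norm (x - y)"
    "\<And>t x. fst x \<ge> sqrt c0 / 2 \<Longrightarrow> \<bar>snd x\<bar> \<le> M \<Longrightarrow> G t x = F t x"
    by (rule F_truncation[OF zero_le_one d M], rule that)
  obtain X where X: "continuous_on {0..1} X" "X 0 = x0"
    "\<And>t. t \<in> {0<..<1} \<Longrightarrow> (X has_vector_derivative G t (X t)) (at t)"
    using picard_lindelof_lipschitz[OF zero_le_one G(1-3), where ?x0.0 = x0] by metis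
  have "open {x :: real \<times> real. sqrt c0 / 2 < fst x}" "open {x :: real \<times> real. \<bar>snd x\<bar> < M}"
    by (intro open_Collect_less continuous_intros)+
  moreover have "(X \<longlongrightarrow> X 0) (at 0 within {0..1})"
    using X(1) by (auto simp: continuous_on_def)
  ultimately have "eventually (\<lambda>t. X t \<in> {x. sqrt c0 / 2 < fst x} \<inter> {x. \<bar>snd x\<bar> < M}) (at 0 within {0..1})"
    using X(2) c0 by (intro topological_tendstoD open_Int) (auto simp: x0_def M_def)
  then obtain e where e: "e > 0" "\<And>t. t \<in> {0..1} \<Longrightarrow> t \<noteq> 0 \<Longrightarrow> dist t 0 < e \<Longrightarrow> sqrt c0 / 2 < fst (X t) \<and> \<bar>snd (X t)\<bar> < M"
    unfolding eventually_at by auto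
  define t0 where "t0 = min e 1"
  have t0: "0 < t0" "t0 \<le> e" "t0 \<le> 1" using e(1) by (auto simp: t0_def)
  have U: "sqrt c0 / 2 < fst (X t) \<and> \<bar>snd (X t)\<bar> < M" if "t \<in> {0..<t0}" for t
    using e(2)[of t] that t0 X(2) c0 by (cases "t = 0") (auto simp: x0_def M_def)
  show thesis
  proof (rule that)
    show "0 < t0" by (fact t0)
    show "ode_sol F x0 t0 X"
      unfolding ode_sol_def
    proof (intro conjI ballI)
      show "continuous_on {0..<t0} X" using t0 by (intro continuous_on_subset[OF X(1)]) auto
      fix t assume "t \<in> {0<..<t0}"
      then show "(X has_vector_derivative F t (X t)) (at t)"
        using X(3)[of t] U[of t] t0 by (simp add: G(4) less_imp_le)
    qed (fact X)
    show "fst (X t) > sqrt c0 / 2" if "t \<in> {0..<t0}" for t using U that by blast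
  qed
qed

text \<open>Chain rule for t = r powr (a - 1): the factor dt/dr = (a-1) t/r cancels the 1/(a-1)
  built into \<open>F\<close> and restores the powers of r.\<close>

lemma ode_sol_imp_flow:
  assumes X: "ode_sol F x0 T X" and pos: "\<And>t. t \<in> {0..<T} \<Longrightarrow> fst (X t) > 0"
    and r: "r > 0" "r powr (a - 1) < T"
  shows "flow (\<lambda>r. fst (X (r powr (a - 1)))) (\<lambda>r. snd (X (r powr (a - 1)))) r"
proof -
  define t where "t = r powr (a - 1)"
  have t: "t > 0" "t < T" "rad t = r" using r by (auto simp: t_def rad_powr)
  have d: "(X has_vector_derivative F t (X t)) (at t)" using X t by (auto simp: ode_sol_def)
  have d1: "DERIV (\<lambda>t. fst (X t)) t :> fst (F t (X t))" and d2: "DERIV (\<lambda>t. snd (X t)) t :> snd (F t (X t))"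
    unfolding has_real_derivative_iff_has_vector_derivative
    using bounded_linear.has_vector_derivative[OF bounded_linear_fst d]
      bounded_linear.has_vector_derivative[OF bounded_linear_snd d] by auto
  have dt: "DERIV (\<lambda>r. r powr (a - 1)) r :> (a - 1) * t / r"
    unfolding t_def by (rule DERIV_powr_const) fact
  have a1: "a - 1 \<noteq> 0" using a_gt_1 by simp
  have q: "r powr (a - 2) = t / r"
    using r powr_diff[of r "a - 1" 1] by (simp add: t_def)
  define y where "y = \<theta> r (fst (X t)) (snd (X t))"
  have fF: "fst (F t (X t)) = r * y / (a - 1)" "snd (F t (X t)) = - (y * D r / (fst (X t))^2) / (a - 1)"
    using t by (auto simp: F_def y_def)
  have "fst (F t (X t)) * ((a - 1) * t / r) = t * y"
    "snd (F t (X t)) * ((a - 1) * t / r) = - (t / r * (y * D r / (fst (X t))^2))"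
    unfolding fF using a1 r by (auto simp: divide_simps)
  with DERIV_chain2[OF d1[unfolded t_def] dt] DERIV_chain2[OF d2[unfolded t_def] dt] pos[of t] t
  show ?thesis
    unfolding flow_def q t_def[symmetric] y_def[symmetric] by (simp add: t_def[symmetric])
qed

text \<open>The constants depend on T but not on the solution or on its lifetime T'. The bound for u
  comes from the local solution up to r0 and from the estimate of 1/(sqrt r f) beyond; given u >= m,
  the equation for v is affine with bounded coefficients and Gronwall applies.\<close>

lemma apriori_bound:
  assumes T: "T > 0"
  obtains m M where "m > 0" "m \<le> sqrt c0 / 2" "\<bar>c1 / (2 * sqrt c0)\<bar> \<le> M"
    "\<And>T' Y t. \<lbrakk>T' \<le> T; ode_sol F x0 T' Y; \<And>t. t \<in> {0..<T'} \<Longrightarrow> fst (Y t) > 0; t \<in> {0..<T'}\<rbrakk>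
      \<Longrightarrow> fst (Y t) \<ge> m \<and> \<bar>snd (Y t)\<bar> \<le> M"
proof -
  have a1: "a - 1 > 0" using a_gt_1 by simp
  obtain t0 X where X: "t0 > 0" "ode_sol F x0 t0 X" "\<And>t. t \<in> {0..<t0} \<Longrightarrow> fst (X t) > sqrt c0 / 2"
    using local_solution by blast
  have Xpos: "fst (X t) > 0" if "t \<in> {0..<t0}" for t
    using X(3)[OF that] c0 by (meson less_trans half_gt_zero real_sqrt_gt_zero)
  define r0 where "r0 = rad (t0 / 2)"
  have r0: "r0 > 0" "r0 powr (a - 1) = t0 / 2"
    using X(1) a1 by (auto simp: r0_def rad_def powr_powr)
  define f where "f Y r = r powr (- a / 2) * fst (Y (r powr (a - 1)))"
    for Y :: "real \<Rightarrow> real \<times> real" and r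
  define f1 where "f1 Y r = r powr (- a / 2) * (r powr (a - 1) *
      \<theta> r (fst (Y (r powr (a - 1)))) (snd (Y (r powr (a - 1)))) - a * fst (Y (r powr (a - 1))) / (2 * r))"
    for Y :: "real \<Rightarrow> real \<times> real" and r
  define R where "R = rad T"
  define J where "J = 1 / (sqrt r0 * f X r0) + 2 * sqrt R / (n - 1) * \<bar>f1 X r0\<bar>"
  have R: "R > 0" using T by (simp add: R_def rad_def)
  have fX: "f X r0 > 0" unfolding f_def r0(2) using r0(1) X(1) Xpos[of "t0 / 2"]
    by (intro mult_pos_pos) auto
  have J: "J > 0" unfolding J_def using fX r0 R n by (intro add_pos_nonneg) auto
  \<comment> \<open>Beyond r0 one has 1 <= J sqrt r r^(-a/2) u <= J sqrt R r0^(-a/2) u, which gives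
    the second entry of the minimum.\<close>
  define m where "m = min (sqrt c0 / 2) (1 / (J * sqrt R * r0 powr (- a / 2)))"
  have m: "m > 0" using c0 J R r0 by (simp add: m_def)
  have low: "fst (Y t) \<ge> m" if Y: "T' \<le> T" "ode_sol F x0 T' Y" "\<And>t. t \<in> {0..<T'} \<Longrightarrow> fst (Y t) > 0"
    and t: "t \<in> {0..<T'}" for T' Y t
  proof -
    \<comment> \<open>By uniqueness every solution continues the same local one, so the data at r0
      entering J are common to all of them.\<close>
    have YX: "Y s = X s" if "s \<in> {0..<min t0 T'}" for s
      using that by (intro ode_sol_F_unique[where T = "min t0 T'" and ?x0.0 = x0] ode_sol_mono[OF Y(2)] ode_sol_mono[OF X(2)] Y(3) Xpos) auto
    show ?thesis
    proof (cases "t < t0 / 2")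
      case True
      then show ?thesis using X(3)[of t] YX[of t] t X(1) by (simp add: m_def min_le_iff_disj)
    next
      case False
      define r where "r = rad t"
      have t': "t > 0" using False X(1) by simp
      have r: "r powr (a - 1) = t" using a1 t' by (simp add: r_def rad_def powr_powr)
      have rr: "r0 \<le> r" "r \<le> R"
        unfolding r_def r0_def R_def rad_def using False X(1) t Y(1) a1 by (auto intro!: powr_mono2)
      have x: "flow (\<lambda>r. fst (Y (r powr (a - 1)))) (\<lambda>r. snd (Y (r powr (a - 1)))) x" "x > 0"
        if "x \<in> {r0..r}" for x
      proof -
        show "x > 0" using that r0 by auto
        then have "x powr (a - 1) \<le> r powr (a - 1)" using that a1 by (intro powr_mono2) auto
        then show "flow (\<lambda>r. fst (Y (r powr (a - 1)))) (\<lambda>r. snd (Y (r powr (a - 1)))) x"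
          using r t \<open>x > 0\<close> by (intro ode_sol_imp_flow[OF Y(2,3)]) auto
      qed
      define f2 where "f2 r = ((n - 1) * f Y r - (n - 1) / f Y r - 2 * r * f1 Y r * (l * r + n - 1) / (f Y r)^2) / (4 * r^2)" for r
      have prof: "profile (f Y) (f1 Y) f2 x" if "x \<in> {r0..r}" for x
        using flow_imp_profile[OF x(2,1)[OF that]] unfolding f_def f1_def f2_def .
      have "1 / (sqrt r * f Y r) \<le> 1 / (sqrt r0 * f Y r0) + 2 * sqrt R / (n - 1) * \<bar>f1 Y r0\<bar>"
        using prof by (intro sqrt_profile_lower_bound[OF n l r0(1) rr]) (auto simp: profile_def)
      moreover have "f Y r0 = f X r0" "f1 Y r0 = f1 X r0"
        using YX[of "t0 / 2"] r0(2) X(1) False t by (auto simp: f_def f1_def)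
      ultimately have J1: "1 / (sqrt r * f Y r) \<le> J" by (simp add: J_def)
      have fY: "f Y r > 0" using prof[of r] rr by (auto simp: profile_def)
      have "1 \<le> J * (sqrt r * f Y r)"
        using J1 fY r0 rr by (simp add: divide_le_eq split: if_splits)
      also have "\<dots> \<le> J * (sqrt R * (r0 powr (- a / 2) * fst (Y t)))"
      proof (intro mult_left_mono mult_mono)
        have "r powr (- a / 2) \<le> r0 powr (- a / 2)"
          using rr r0 a_gt_1 by (intro powr_mono2') auto
        then show "f Y r \<le> r0 powr (- a / 2) * fst (Y t)"
          unfolding f_def r using Y(3)[OF t] by (intro mult_right_mono) auto
      qed (use rr r0 fY J R in auto)
      finally have "1 / (J * sqrt R * r0 powr (- a / 2)) \<le> fst (Y t)"
        using J R r0 by (simp add: field_simps)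
      then show ?thesis by (simp add: m_def)
    qed
  qed
  obtain b where b: "b \<ge> 1" "\<And>t. t \<in> {0..T} \<Longrightarrow> rad t \<le> b"
    "\<And>t. t \<in> {0..T} \<Longrightarrow> \<bar>S (rad t)\<bar> \<le> b" "\<And>t. t \<in> {0..T} \<Longrightarrow> \<bar>D (rad t)\<bar> \<le> b"
    using bounded_coeffs[of T] T by auto
  \<comment> \<open>Chosen so that |v'| <= K (1 + |v|). Then (v^2)' <= 2 K (|v| + v^2) <= 4 K (1 +
    v^2), whence the exponent 4 K T in M.\<close>
  define K where "K = (b + b / m) * (b / m^2) / (a - 1)"
  define k where "k = c1 / (2 * sqrt c0)"
  define M where "M = (1 + k^2) * exp (4 * K * T)"
  have K: "K \<ge> 0" using b(1) m a1 by (simp add: K_def)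
  have up: "\<bar>snd (Y t)\<bar> \<le> M" if Y: "T' \<le> T" "ode_sol F x0 T' Y" "\<And>t. t \<in> {0..<T'} \<Longrightarrow> fst (Y t) > 0"
    and t: "t \<in> {0..<T'}" for T' Y t
  proof -
    define w where "w t = (1 + (snd (Y t))^2) * exp (- 4 * K * t)" for t
    have "w t \<le> w 0"
    proof (rule DERIV_nonpos_imp_decreasing_open[of 0 t w])
      show "0 \<le> t" using t by simp
      have "continuous_on {0..t} Y" using Y(2) t by (auto simp: ode_sol_def elim: continuous_on_subset)
      then show "continuous_on {0..t} w" unfolding w_def by (intro continuous_intros)
      fix s assume s: "0 < s" "s < t"
      have "(Y has_vector_derivative F s (Y s)) (at s)" using Y(2) s t by (auto simp: ode_sol_def)
      then have ds: "DERIV (\<lambda>t. snd (Y t)) s :> snd (F s (Y s))"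
        unfolding has_real_derivative_iff_has_vector_derivative
        by (rule bounded_linear.has_vector_derivative[OF bounded_linear_snd])
      define v where "v = snd (Y s)"
      have sT: "s \<in> {0..T}" using s t Y(1) by auto
      have my: "m \<le> fst (Y s)" using low[OF Y, of s] s t by auto
      have Fb: "\<bar>snd (F s (Y s))\<bar> \<le> K * (1 + \<bar>v\<bar>)"
      proof -
        have "\<bar>\<theta> (rad s) (fst (Y s)) v\<bar> \<le> \<bar>rad s\<bar> * \<bar>v\<bar> + \<bar>S (rad s)\<bar> / \<bar>fst (Y s)\<bar>"
          unfolding \<theta>_def by (metis abs_mult abs_divide abs_triangle_ineq4)
        also have "\<dots> \<le> b * \<bar>v\<bar> + b / m"
          using b(1) b(2-4)[OF sT] my m rad_nonneg[of s] by (intro add_mono mult_right_mono frac_le) auto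
        also have "\<dots> \<le> (b + b / m) * (1 + \<bar>v\<bar>)" using b(1) m by (simp add: algebra_simps)
        finally have th: "\<bar>\<theta> (rad s) (fst (Y s)) v\<bar> \<le> (b + b / m) * (1 + \<bar>v\<bar>)" .
        have "\<bar>snd (F s (Y s))\<bar> = \<bar>\<theta> (rad s) (fst (Y s)) v\<bar> * (\<bar>D (rad s)\<bar> / (fst (Y s))^2) / (a - 1)"
          using a1 by (simp add: F_def v_def abs_mult)
        also have "\<dots> \<le> ((b + b / m) * (1 + \<bar>v\<bar>)) * (b / m^2) / (a - 1)"
          using th b(1) b(2-4)[OF sT] my m a1 
          by (intro divide_right_mono mult_mono frac_le power_mono) auto
        finally show ?thesis by (simp add: K_def mult_ac)
      qed
      have "v * snd (F s (Y s)) \<le> \<bar>v\<bar> * (K * (1 + \<bar>v\<bar>))"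
        by (rule order_trans[OF abs_ge_self]) (auto simp: abs_mult intro!: mult_left_mono Fb)
      also have "\<dots> = K * (\<bar>v\<bar> + v^2)" by (simp add: algebra_simps power2_eq_square)
      also have "\<dots> \<le> K * (2 * (1 + v^2))"
      proof (intro mult_left_mono K)
        have "0 \<le> (\<bar>v\<bar> - 1)^2 + v^2 + 3" by simp
        then show "\<bar>v\<bar> + v^2 \<le> 2 * (1 + v^2)" by (simp add: power2_diff)
      qed
      finally have "(2 * (v * snd (F s (Y s))) - 4 * K * (1 + v^2)) * exp (- 4 * K * s) \<le> 0"
        by (intro mult_nonpos_nonneg) (auto simp: algebra_simps)
      moreover have "DERIV w s :> (2 * (v * snd (F s (Y s))) - 4 * K * (1 + v^2)) * exp (- 4 * K * s)"
      proof -
        have "DERIV (\<lambda>t. 1 + (snd (Y t))^2) s :> 2 * (v * snd (F s (Y s)))"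
          unfolding v_def by (rule DERIV_cong, (rule derivative_intros ds)+) simp
        moreover have "DERIV (\<lambda>t. exp (- 4 * K * t)) s :> - 4 * K * exp (- 4 * K * s)"
          by (auto intro!: derivative_eq_intros)
        ultimately show ?thesis
          unfolding w_def by (rule DERIV_cong[OF DERIV_mult]) (simp add: v_def algebra_simps)
      qed
      ultimately show "\<exists>y. DERIV w s :> y \<and> y \<le> 0" by blast
    qed
    also have "w 0 = 1 + k^2" using Y(2) by (simp add: w_def ode_sol_def x0_def k_def)
    finally have "1 + (snd (Y t))^2 \<le> (1 + k^2) * exp (4 * K * t)"
      by (simp add: w_def exp_minus field_simps)
    also have "\<dots> \<le> M" unfolding M_def using K t Y(1) by (intro mult_left_mono) (auto intro: mult_left_mono)
    finally have "1 + (snd (Y t))^2 \<le> M" .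
    moreover have "0 \<le> (\<bar>snd (Y t)\<bar> - 1)^2 + (snd (Y t))^2 + 1" by simp
    ultimately show ?thesis
      by (simp add: power2_diff)
  qed
  have "\<bar>k\<bar> \<le> M"
  proof -
    have "0 \<le> (\<bar>k\<bar> - 1)^2 + k^2 + 1" by simp
    then have "\<bar>k\<bar> \<le> (1 + k^2) * 1" by (simp add: power2_diff)
    also have "\<dots> \<le> M" unfolding M_def using K T by (intro mult_left_mono) auto
    finally show ?thesis .
  qed
  then show thesis
    using m low up by (intro that[of m M]) (auto simp: m_def k_def)
qed

lemma solution_upto:
  assumes T: "T > 0"
  shows "\<exists>X. ode_sol F x0 T X \<and> (\<forall>t\<in>{0..<T}. fst (X t) > 0)"
proof -
  obtain m M where mM: "m > 0" "m \<le> sqrt c0 / 2" "\<bar>c1 / (2 * sqrt c0)\<bar> \<le> M"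
    and ap: "\<And>T' Y t. \<lbrakk>T' \<le> T; ode_sol F x0 T' Y; \<And>t. t \<in> {0..<T'} \<Longrightarrow> fst (Y t) > 0; t \<in> {0..<T'}\<rbrakk>
      \<Longrightarrow> fst (Y t) \<ge> m \<and> \<bar>snd (Y t)\<bar> \<le> M"
    using apriori_bound[OF T] by metis
  have M: "M + 1 \<ge> 0" and m2: "m / 2 > 0"
    using mM abs_ge_zero[of "c1 / (2 * sqrt c0)"] by linarith+
  \<comment> \<open>The open set is a slight enlargement of the region given by the a priori bound,
    so that the closed region lies inside it, and the truncation is exact on it.\<close>
  define U where "U = {x :: real \<times> real. m / 2 < fst x} \<inter> {x. \<bar>snd x\<bar> < M + 1}"
  define K where "K = {x :: real \<times> real. m \<le> fst x} \<inter> {x. \<bar>snd x\<bar> \<le> M}"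
  obtain G L where G: "L > 0" "continuous_on ({0..T} \<times> UNIV) (\<lambda>(t, x). G t x)"
    "\<And>t x y. t \<in> {0..T} \<Longrightarrow> norm (G t x - G t y) \<le> L * norm (x - y)"
    "\<And>t x. fst x \<ge> m / 2 \<Longrightarrow> \<bar>snd x\<bar> \<le> M + 1 \<Longrightarrow> G t x = F t x"
    by (rule F_truncation[OF less_imp_le[OF T] m2 M], rule that)
  have "open U"
    unfolding U_def by (intro open_Int open_Collect_less continuous_intros)
  moreover have "closed K"
    unfolding K_def by (intro closed_Int closed_Collect_le continuous_intros)
  moreover have "K \<subseteq> U" using mM(1) by (auto simp: K_def U_def)
  moreover have "x0 \<in> U"
    using mM c0 real_sqrt_gt_zero[OF c0] by (auto simp: U_def x0_def)
  moreover have "Y t \<in> K" if "T' \<le> T" "ode_sol F x0 T' Y" "\<And>t. t \<in> {0..<T'} \<Longrightarrow> Y t \<in> U"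
    "t \<in> {0..<T'}" for T' Y t
  proof -
    have "fst (Y t) > 0" if "t \<in> {0..<T'}" for t
      using \<open>\<And>t. t \<in> {0..<T'} \<Longrightarrow> Y t \<in> U\<close>[OF that] mM(1) by (auto simp: U_def)
    from ap[OF that(1,2) this that(4)] show ?thesis by (simp add: K_def)
  qed
  moreover have "G t x = F t x" if "x \<in> U" for t x
    using that by (intro G(4)) (auto simp: U_def)
  ultimately obtain X where "ode_sol F x0 T X" "\<And>t. t \<in> {0..<T} \<Longrightarrow> X t \<in> U"
    using ode_sol_truncation[OF T G(1-3), of U F x0 K] by metis
  moreover have "x \<in> U \<Longrightarrow> fst x > 0" for x using mM(1) by (auto simp: U_def)
  ultimately show ?thesis by blast
qed

lemma global_flow:
  obtains u v where "\<And>r. r > 0 \<Longrightarrow> flow u v r"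
    "(u \<longlongrightarrow> sqrt c0) (at_right 0)" "(v \<longlongrightarrow> c1 / (2 * sqrt c0)) (at_right 0)"
proof -
  obtain Z where Z: "\<And>T. T > 0 \<Longrightarrow> ode_sol F x0 T (Z T)"
    "\<And>T t. T > 0 \<Longrightarrow> t \<in> {0..<T} \<Longrightarrow> fst (Z T t) > 0"
    using solution_upto by metis
  \<comment> \<open>Solutions live on half-open intervals [0, T), so time t is read off from the one
    on [0, t + 1); uniqueness makes the pieces agree.\<close>
  define X where "X t = Z (t + 1) t" for t
  have XZ: "X t = Z T t" if "t \<in> {0..<T}" for t T
    unfolding X_def using that
    by (intro ode_sol_F_unique[where T = "min (t + 1) T" and ?x0.0 = x0])
      (auto intro: Z ode_sol_mono[OF Z(1)])
  have pos: "fst (X t) > 0" if "t \<ge> 0" for t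
    unfolding X_def using that by (intro Z) auto
  have sol: "ode_sol F x0 T X" if T: "T > 0" for T
    unfolding ode_sol_def
  proof (intro conjI ballI)
    have "continuous_on {0..<T} (Z T)" using Z(1)[OF T] by (simp add: ode_sol_def)
    then show "continuous_on {0..<T} X"
      by (rule continuous_on_eq) (rule XZ[symmetric])
    show "X 0 = x0" using XZ[of 0 T] Z(1)[OF T] T by (simp add: ode_sol_def)
    fix t assume t: "t \<in> {0<..<T}"
    then have "(Z T has_vector_derivative F t (X t)) (at t)"
      using Z(1)[OF T] XZ[of t T] by (auto simp: ode_sol_def)
    then show "(X has_vector_derivative F t (X t)) (at t)"
      by (rule has_vector_derivative_transform_within_open[of _ _ _ "{0<..<T}"])
        (use t in \<open>auto intro: XZ[symmetric]\<close>)
  qed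
  have a1: "a - 1 > 0" using a_gt_1 by simp
  have "LIM r at_right 0. r powr (a - 1) :> at_right 0"
    by (rule filterlim_powr_at_right_0) fact
  moreover have "(X \<longlongrightarrow> x0) (at_right 0)"
  proof -
    have "continuous_on {0..1} X"
      using sol[of 2] by (auto simp: ode_sol_def elim: continuous_on_subset)
    then have "(X \<longlongrightarrow> X 0) (at_right 0)"
      unfolding continuous_on_def
      by (metis at_within_Icc_at_right atLeastAtMost_iff order_refl zero_le_one zero_less_one)
    then show ?thesis using sol[of 1] by (simp add: ode_sol_def)
  qed
  ultimately have lim: "((\<lambda>r. X (r powr (a - 1))) \<longlongrightarrow> x0) (at_right 0)"
    by (rule filterlim_compose[rotated])
  show thesis
  proof (rule that)
    show "flow (\<lambda>r. fst (X (r powr (a - 1)))) (\<lambda>r. snd (X (r powr (a - 1)))) r" if "r > 0" for r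
      using that pos by (intro ode_sol_imp_flow[OF sol[of "r powr (a - 1) + 1"]]) (auto intro: add_pos_pos)
    show "((\<lambda>r. fst (X (r powr (a - 1)))) \<longlongrightarrow> sqrt c0) (at_right 0)"
      using tendsto_fst[OF lim] by (simp add: x0_def)
    show "((\<lambda>r. snd (X (r powr (a - 1)))) \<longlongrightarrow> c1 / (2 * sqrt c0)) (at_right 0)"
      using tendsto_snd[OF lim] by (simp add: x0_def)
  qed
qed

text \<open>The two limits at r = 0 become continuity of the time-changed solution at t = 0. This
  puts any flow with these limits in the scope of the uniqueness result for
  \<open>ode_sol\<close>.\<close>

lemma flow_imp_ode_sol:
  assumes flow: "\<And>r. r > 0 \<Longrightarrow> flow u v r"
    and lim: "(u \<longlongrightarrow> sqrt c0) (at_right 0)" "(v \<longlongrightarrow> c1 / (2 * sqrt c0)) (at_right 0)"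
  defines "X \<equiv> \<lambda>t. if t \<le> 0 then x0 else (u (rad t), v (rad t))"
  shows "ode_sol F x0 T X"
proof -
  have a1: "a - 1 > 0" using a_gt_1 by simp
  have d: "(X has_vector_derivative F t (X t)) (at t)" if t: "t > 0" for t
  proof -
    define r where "r = rad t"
    have r: "r > 0" using t by (simp add: r_def rad_def)
    have tr: "r powr (a - 1) = t" using t a1 by (simp add: r_def rad_def powr_powr)
    have q: "r powr (a - 2) = t / r"
      using r powr_diff[of r "a - 1" 1] by (simp add: tr)
    have dr: "DERIV rad t :> 1 / (a - 1) * r / t"
      unfolding rad_def r_def by (rule DERIV_powr_const) fact
    define y where "y = \<theta> r (u r) (v r)"
    have du: "DERIV u r :> t * y" and dv: "DERIV v r :> - (t / r * (y * D r / (u r)^2))"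
      using flow[OF r] by (auto simp: flow_def tr q y_def)
    have "DERIV (\<lambda>t. u (rad t)) t :> r * y / (a - 1)"
      using DERIV_chain2[OF du[unfolded r_def] dr] t by (simp add: r_def mult.commute)
    moreover have "DERIV (\<lambda>t. v (rad t)) t :> - (y * D r / (u r)^2) / (a - 1)"
      using DERIV_chain2[OF dv[unfolded r_def] dr] t r by (simp add: r_def)
    ultimately have "((\<lambda>t. (u (rad t), v (rad t))) has_vector_derivative
        (r * y / (a - 1), - (y * D r / (u r)^2) / (a - 1))) (at t)"
      unfolding has_real_derivative_iff_has_vector_derivative by (rule has_vector_derivative_Pair)
    then have "(X has_vector_derivative (r * y / (a - 1), - (y * D r / (u r)^2) / (a - 1))) (at t)"
      by (rule has_vector_derivative_transform_within_open[of _ _ _ "{0<..}"])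
        (use t in \<open>auto simp: X_def\<close>)
    moreover have "X t = (u r, v r)" using t by (simp add: X_def r_def)
    moreover have "F t (u r, v r) = (r * y / (a - 1), - (y * D r / (u r)^2) / (a - 1))"
      by (simp add: F_def r_def[symmetric] y_def)
    ultimately show ?thesis by simp
  qed
  have "continuous_on {0..<T} X"
    unfolding continuous_on_eq_continuous_within
  proof
    fix t assume t: "t \<in> {0..<T}"
    show "continuous (at t within {0..<T}) X"
    proof (cases "t = 0")
      case False
      then show ?thesis
        using t by (intro continuous_at_imp_continuous_at_within[OF has_vector_derivative_continuous[OF d]]) auto
    next
      case True
      have *: "LIM t at_right 0. rad t :> at_right 0"
        unfolding rad_def using a1 by (intro filterlim_powr_at_right_0) simp
      have "((\<lambda>t. (u (rad t), v (rad t))) \<longlongrightarrow> x0) (at_right 0)"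
        unfolding x0_def by (intro tendsto_Pair filterlim_compose[OF lim(1) *] filterlim_compose[OF lim(2) *])
      then have "(X \<longlongrightarrow> x0) (at_right 0)"
        by (rule Lim_transform_eventually) (auto simp: eventually_at_filter X_def)
      moreover have "at 0 within {0..<T} \<le> at_right (0::real)"
        unfolding at_within_def by (rule inf_mono) auto
      ultimately show ?thesis
        using True by (simp add: continuous_within X_def tendsto_mono)
    qed
  qed
  then show ?thesis using d by (auto simp: ode_sol_def X_def)
qed

lemma flow_unique:
  assumes "\<And>r. r > 0 \<Longrightarrow> flow u v r"
    and "(u \<longlongrightarrow> sqrt c0) (at_right 0)" "(v \<longlongrightarrow> c1 / (2 * sqrt c0)) (at_right 0)"
    and "\<And>r. r > 0 \<Longrightarrow> flow u' v' r"
    and "(u' \<longlongrightarrow> sqrt c0) (at_right 0)" "(v' \<longlongrightarrow> c1 / (2 * sqrt c0)) (at_right 0)"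
    and r: "r > 0"
  shows "u r = u' r"
proof -
  define X where "X u v t = (if t \<le> 0 then x0 else (u (rad t), v (rad t)))" for u v t
  have pos: "fst (X u v t) > 0" if "\<And>r. r > 0 \<Longrightarrow> flow u v r" for u v t
    using that[of "rad t"] c0 by (auto simp: X_def x0_def flow_def rad_def)
  have "X u v (r powr (a - 1)) = X u' v' (r powr (a - 1))"
    using flow_imp_ode_sol[OF assms(1-3)] flow_imp_ode_sol[OF assms(4-6)] pos assms(1,4)
    unfolding X_def[symmetric]
    by (intro ode_sol_F_unique[where T = "r powr (a - 1) + 1" and ?x0.0 = x0]) (auto simp: X_def)
  then show ?thesis using r by (simp add: X_def rad_powr)
qed

end

section \<open>Asymptotics at the origin\<close>

context soliton
begin

text \<open>The r^(2a) coefficient of r^a h, since 2 A = c2. It is produced by the first correction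
  of 2 u v, which is 2 a c3 r^(a-1).\<close>

definition c3 :: real where
  "c3 = ((2 * A)^2 + (n - 1) * (2 * A)) / (4 * c0 * a * (a - 1))"

text \<open>Since (u^2)' = 2 r^a u v - 2 r^(a-1) S, adding the explicit primitive of 2 r^(a-1) S to
  u^2 leaves a function with derivative r^a * 2 u v. The last bracket is the primitive of r^a ln
  r.\<close>

definition W :: "(real \<Rightarrow> real) \<Rightarrow> real \<Rightarrow> real" where
  "W u r = (u r)^2 + 2 * A / a * r powr a
     - 2 * B * (r powr (a + 1) * ln r / (a + 1) - r powr (a + 1) / (a + 1)^2)"

text \<open>The first formula rests on u \<open>\<theta>\<close> = r u v - S. The second shows that
  2 u v, the quantity tending to c1, varies at rate r^(a-2) times a factor with a limit at
  0.\<close>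

lemma
  assumes r: "r > 0" and flow: "flow u v r"
  shows DERIV_W: "DERIV (W u) r :> r powr a * (2 * v r * u r)"
    and DERIV_chi: "DERIV (\<lambda>r. 2 * v r * u r) r :> r powr (a - 2) *
      (- 2 * \<theta> r (u r) (v r) * D r / u r + 2 * (r * v r) * \<theta> r (u r) (v r))"
proof -
  have a: "a > 1" by (rule a_gt_1)
  define q where "q = r powr (a - 2)"
  have q1: "r powr (a - 1) = q * r" and qa: "r powr a = q * r * r" and qa1: "r powr (a + 1) = q * r * r * r"
    using r by (auto simp: q_def powr_diff powr_add powr_numeral power2_eq_square)
  define y where "y = \<theta> r (u r) (v r)"
  have u: "u r > 0" and du: "DERIV u r :> q * r * y" and dv: "DERIV v r :> - (q * (y * D r / (u r)^2))"
    using flow by (auto simp: flow_def q1 q_def[symmetric] y_def)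
  have d1: "DERIV (\<lambda>r. r powr a) r :> a * (q * r)"
    using DERIV_powr_const[OF r, of a] r by (simp add: qa)
  have d2: "DERIV (\<lambda>r. r powr (a + 1)) r :> (a + 1) * (q * r * r)"
    using DERIV_powr_const[OF r, of "a + 1"] r by (simp add: qa1 mult.assoc)
  have dln: "DERIV ln r :> 1 / r" using r by (simp add: DERIV_ln_divide)
  have "DERIV (\<lambda>r. r powr (a + 1) * ln r / (a + 1) - r powr (a + 1) / (a + 1)^2) r :>
      ((a + 1) * (q * r * r) * ln r + 1 / r * (q * r * r * r)) / (a + 1)
      - (a + 1) * (q * r * r) / (a + 1)^2"
    using DERIV_diff[OF DERIV_cdivide[OF DERIV_mult[OF d2 dln], of "a + 1"] DERIV_cdivide[OF d2, of "(a + 1)^2"]]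
    by (simp add: qa1)
  also have "((a + 1) * (q * r * r) * ln r + 1 / r * (q * r * r * r)) / (a + 1)
      - (a + 1) * (q * r * r) / (a + 1)^2 = q * r * r * ln r"
  proof -
    have "a + 1 \<noteq> 0" using a by simp
    then show ?thesis using r by (simp add: add_divide_distrib power2_eq_square)
  qed
  finally have dB: "DERIV (\<lambda>r. r powr (a + 1) * ln r / (a + 1) - r powr (a + 1) / (a + 1)^2) r :> q * r * r * ln r" .
  have du2: "DERIV (\<lambda>r. (u r)^2) r :> 2 * u r * (q * r * y)"
    using DERIV_mult[OF du du] by (simp add: power2_eq_square algebra_simps)
  have "u r * y = r * v r * u r - S r"
    using u by (simp add: y_def \<theta>_def field_simps)
  then have uy: "u r * y = r * v r * u r - A + B * (r * ln r)" by (simp add: S_def)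
  have "DERIV (W u) r :> 2 * u r * (q * r * y) + 2 * A / a * (a * (q * r)) - 2 * B * (q * r * r * ln r)"
    unfolding W_def using DERIV_diff[OF DERIV_add[OF du2 DERIV_cmult[OF d1]] DERIV_cmult[OF dB]] .
  also have "2 * u r * (q * r * y) + 2 * A / a * (a * (q * r)) - 2 * B * (q * r * r * ln r)
      = 2 * (q * r) * (u r * y + A - B * (r * ln r))"
    using a by (simp add: algebra_simps)
  also have "\<dots> = r powr a * (2 * v r * u r)" unfolding uy qa by (simp add: algebra_simps)
  finally show "DERIV (W u) r :> r powr a * (2 * v r * u r)" .
  have "DERIV (\<lambda>r. 2 * v r * u r) r :> 2 * (- (q * (y * D r / (u r)^2))) * u r + q * r * y * (2 * v r)"
    using DERIV_mult[OF DERIV_cmult[OF dv] du] .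
  also have "2 * (- (q * (y * D r / (u r)^2))) * u r + q * r * y * (2 * v r)
      = q * (- 2 * y * D r / u r + 2 * (r * v r) * y)"
    using u by (simp add: field_simps power2_eq_square)
  finally show "DERIV (\<lambda>r. 2 * v r * u r) r :> r powr (a - 2) *
      (- 2 * \<theta> r (u r) (v r) * D r / u r + 2 * (r * v r) * \<theta> r (u r) (v r))"
    by (simp add: y_def q_def)
qed

text \<open>L'Hospital twice: for 2 u v - c1 against r^(a-1), then for the error of \<open>W\<close>
  against r^(2a), whose derivative quotient is the deviation of the first quotient from its limit,
  divided by 2 a.\<close>

lemma flow_asymptotics:
  assumes flow: "\<And>r. r > 0 \<Longrightarrow> flow u v r"
    and u: "(u \<longlongrightarrow> sqrt c0) (at_right 0)" and v: "(v \<longlongrightarrow> c1 / (2 * sqrt c0)) (at_right 0)"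
  shows "((\<lambda>r. (2 * v r * u r - c1) / r powr (a - 1)) \<longlongrightarrow> 2 * a * c3) (at_right 0)"
    and "((\<lambda>r. (W u r - c0 - c1 / (a + 1) * r powr (a + 1) - c3 * r powr (2 * a)) / r powr (2 * a)) \<longlongrightarrow> 0)
      (at_right 0)"
proof -
  have a: "a > 1" by (rule a_gt_1)
  have d: "sqrt c0 > 0" using c0 by simp
  have id: "((\<lambda>r. r) \<longlongrightarrow> 0) (at_right (0::real))" by (rule tendsto_ident_at)
  have ev: "eventually (\<lambda>r. r > 0) (at_right (0::real))" by (rule eventually_at_right_less)
  have S: "(S \<longlongrightarrow> A) (at_right 0)"
    unfolding S_def using tendsto_diff[OF tendsto_const tendsto_mult_left[OF tendsto_mult_ln_at_right_0, of B], of A] by simp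
  have D: "(D \<longlongrightarrow> (n - 1) / 2 + A) (at_right 0)"
    unfolding D_def
    using tendsto_diff[OF tendsto_add[OF tendsto_const tendsto_mult_left[OF id, of "l / 2"], of "(n - 1) / 2 + A"]
        tendsto_mult_left[OF tendsto_mult_ln_at_right_0, of B]] by simp
  have rv: "((\<lambda>r. r * v r) \<longlongrightarrow> 0) (at_right 0)"
    using tendsto_mult[OF id v] by simp
  have th: "((\<lambda>r. \<theta> r (u r) (v r)) \<longlongrightarrow> - A / sqrt c0) (at_right 0)"
    unfolding \<theta>_def using tendsto_diff[OF rv tendsto_divide[OF S u]] d by simp
  have E: "((\<lambda>r. (- 2 * \<theta> r (u r) (v r) * D r / u r + 2 * (r * v r) * \<theta> r (u r) (v r)) / (a - 1))
      \<longlongrightarrow> (- 2 * (- A / sqrt c0) * ((n - 1) / 2 + A) / sqrt c0 + 2 * 0 * (- A / sqrt c0)) / (a - 1)) (at_right 0)"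
    using d a by (intro tendsto_intros th D u rv) auto
  \<comment> \<open>At the origin \<open>\<theta>\<close> tends to -A/sqrt c0 and D to (n-1)/2 + A;
    the value is 2 A ((n-1)/2 + A)/(c0 (a-1)).\<close>
  have c3: "(- 2 * (- A / sqrt c0) * ((n - 1) / 2 + A) / sqrt c0 + 2 * 0 * (- A / sqrt c0)) / (a - 1) = 2 * a * c3"
  proof -
    have "- 2 * (- A / sqrt c0) * ((n - 1) / 2 + A) / sqrt c0 = 2 * A * ((n - 1) / 2 + A) / (sqrt c0 * sqrt c0)"
      by simp
    also have "sqrt c0 * sqrt c0 = c0" using c0 by simp
    finally have *: "- 2 * (- A / sqrt c0) * ((n - 1) / 2 + A) / sqrt c0 = 2 * A * ((n - 1) / 2 + A) / c0" .
    show ?thesis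
      unfolding * c3_def using a c0 by (simp add: field_simps power2_eq_square)
  qed
  show chi: "((\<lambda>r. (2 * v r * u r - c1) / r powr (a - 1)) \<longlongrightarrow> 2 * a * c3) (at_right 0)"
  proof (rule lhopital_right_0)
    show "((\<lambda>r. 2 * v r * u r - c1) \<longlongrightarrow> 0) (at_right 0)"
      using tendsto_diff[OF tendsto_mult[OF tendsto_mult[OF tendsto_const v, of 2] u] tendsto_const, of c1] d by simp
    show "((\<lambda>r. r powr (a - 1)) \<longlongrightarrow> 0) (at_right 0)" using a by (intro tendsto_powr_at_right_0) simp
    show "eventually (\<lambda>r. r powr (a - 1) \<noteq> 0) (at_right 0)" using ev by eventually_elim simp
    show "eventually (\<lambda>r. (a - 1) * r powr (a - 1) / r \<noteq> 0) (at_right 0)"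
      using ev by eventually_elim (use a in simp)
    show "eventually (\<lambda>r. DERIV (\<lambda>r. 2 * v r * u r - c1) r :> r powr (a - 2) *
      (- 2 * \<theta> r (u r) (v r) * D r / u r + 2 * (r * v r) * \<theta> r (u r) (v r))) (at_right 0)"
      using ev
    proof eventually_elim
      case (elim r)
      show ?case using DERIV_diff[OF DERIV_chi[OF elim flow[OF elim]] DERIV_const[of c1]] by simp
    qed
    show "eventually (\<lambda>r. DERIV (\<lambda>r. r powr (a - 1)) r :> (a - 1) * r powr (a - 1) / r) (at_right 0)"
      using ev by eventually_elim (rule DERIV_powr_const)
    show "((\<lambda>r. r powr (a - 2) *
      (- 2 * \<theta> r (u r) (v r) * D r / u r + 2 * (r * v r) * \<theta> r (u r) (v r)) / ((a - 1) * r powr (a - 1) / r))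
        \<longlongrightarrow> 2 * a * c3) (at_right 0)"
    proof (rule Lim_transform_eventually[OF E[unfolded c3]])
      show "eventually (\<lambda>r. (- 2 * \<theta> r (u r) (v r) * D r / u r + 2 * (r * v r) * \<theta> r (u r) (v r)) / (a - 1)
        = r powr (a - 2) * (- 2 * \<theta> r (u r) (v r) * D r / u r + 2 * (r * v r) * \<theta> r (u r) (v r))
            / ((a - 1) * r powr (a - 1) / r)) (at_right 0)"
        using ev
      proof eventually_elim
        case (elim r)
        have "r powr (a - 1) = r powr (a - 2) * r"
          using elim by (simp add: powr_diff powr_numeral power2_eq_square)
        then show ?case using elim a by simp
      qed
    qed
  qed
  show "((\<lambda>r. (W u r - c0 - c1 / (a + 1) * r powr (a + 1) - c3 * r powr (2 * a)) / r powr (2 * a)) \<longlongrightarrow> 0) (at_right 0)"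
  proof (rule lhopital_right_0)
    have p: "((\<lambda>r. r powr b) \<longlongrightarrow> 0) (at_right 0)" if "b > 0" for b :: real
      by (rule tendsto_powr_at_right_0) fact
    have "((\<lambda>r. r powr a * (r * ln r)) \<longlongrightarrow> 0) (at_right 0)"
      using tendsto_mult[OF p[of a] tendsto_mult_ln_at_right_0] a by simp
    then have pl: "((\<lambda>r. r powr (a + 1) * ln r) \<longlongrightarrow> 0) (at_right 0)"
      by (rule Lim_transform_eventually) (use ev in \<open>eventually_elim, simp add: powr_add\<close>)
    have "((\<lambda>r. W u r - c0 - c1 / (a + 1) * r powr (a + 1) - c3 * r powr (2 * a)) \<longlongrightarrow>
      ((sqrt c0)^2 + 2 * A / a * 0 - 2 * B * (0 / (a + 1) - 0 / (a + 1)^2)) - c0 - c1 / (a + 1) * 0 - c3 * 0) (at_right 0)"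
      unfolding W_def by (intro tendsto_intros u p pl) (use a in auto)
    then show "((\<lambda>r. W u r - c0 - c1 / (a + 1) * r powr (a + 1) - c3 * r powr (2 * a)) \<longlongrightarrow> 0) (at_right 0)"
      using c0 by simp
    show "((\<lambda>r. r powr (2 * a)) \<longlongrightarrow> 0) (at_right 0)" using a by (intro p) simp
    show "eventually (\<lambda>r. r powr (2 * a) \<noteq> 0) (at_right 0)" using ev by eventually_elim simp
    show "eventually (\<lambda>r. 2 * a * r powr (2 * a) / r \<noteq> 0) (at_right 0)"
      using ev by eventually_elim (use a in simp)
    show "eventually (\<lambda>r. DERIV (\<lambda>r. W u r - c0 - c1 / (a + 1) * r powr (a + 1) - c3 * r powr (2 * a)) r :>
        r powr a * (2 * v r * u r) - 0 - c1 / (a + 1) * ((a + 1) * r powr (a + 1) / r)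
        - c3 * (2 * a * r powr (2 * a) / r)) (at_right 0)"
      using ev
      by eventually_elim (intro DERIV_diff DERIV_W DERIV_const DERIV_cmult DERIV_powr_const flow)
    show "eventually (\<lambda>r. DERIV (\<lambda>r. r powr (2 * a)) r :> 2 * a * r powr (2 * a) / r) (at_right 0)"
      using ev by eventually_elim (rule DERIV_powr_const)
    have "((\<lambda>r. ((2 * v r * u r - c1) / r powr (a - 1) - 2 * a * c3) / (2 * a)) \<longlongrightarrow> (2 * a * c3 - 2 * a * c3) / (2 * a)) (at_right 0)"
      using a by (intro tendsto_intros chi) auto
    then have lim: "((\<lambda>r. ((2 * v r * u r - c1) / r powr (a - 1) - 2 * a * c3) / (2 * a)) \<longlongrightarrow> 0) (at_right 0)"
      by simp
    show "((\<lambda>r. (r powr a * (2 * v r * u r) - 0 - c1 / (a + 1) * ((a + 1) * r powr (a + 1) / r)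
        - c3 * (2 * a * r powr (2 * a) / r)) / (2 * a * r powr (2 * a) / r)) \<longlongrightarrow> 0) (at_right 0)"
    proof (rule Lim_transform_eventually[OF lim])
      show "eventually (\<lambda>r. ((2 * v r * u r - c1) / r powr (a - 1) - 2 * a * c3) / (2 * a) =
        (r powr a * (2 * v r * u r) - 0 - c1 / (a + 1) * ((a + 1) * r powr (a + 1) / r)
        - c3 * (2 * a * r powr (2 * a) / r)) / (2 * a * r powr (2 * a) / r)) (at_right 0)"
        using ev
      proof eventually_elim
        case (elim r)
        define p where "p = r powr a"
        have p: "p > 0" using elim by (simp add: p_def)
        have pw: "r powr (a + 1) = p * r" "r powr (a - 1) = p / r" "r powr (2 * a) = p * p"
          using elim powr_add[of r a a] by (auto simp: p_def powr_add powr_diff)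
        have c1: "c1 / (a + 1) * ((a + 1) * (p * r) / r) = c1 * p" using elim a by simp
        show ?case
          unfolding pw p_def[symmetric] c1 using elim a p by (simp add: field_simps)
      qed
    qed
  qed
qed

end

section \<open>Recovering the initial value from the expansion\<close>

context soliton
begin

text \<open>With no bound on v at hand, the derivative of x = 2 u v is controlled only by K r^(a-2)
  (1 + x^2). Passing to arctan x absorbs the quadratic growth and leaves a bound integrable at
  0.\<close>

lemma chi_deriv_bound:
  assumes flow: "\<And>r. r > 0 \<Longrightarrow> flow u v r"
    and u: "(u \<longlongrightarrow> sqrt c0) (at_right 0)"
  obtains K r1 where "K \<ge> 0" "r1 > 0" "\<And>r. \<lbrakk>0 < r; r < r1\<rbrakk> \<Longrightarrow>
    \<exists>y. DERIV (\<lambda>r. arctan (2 * v r * u r)) r :> y \<and> \<bar>y\<bar> \<le> K * r powr (a - 2)"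
proof -
  have a: "a > 1" by (rule a_gt_1)
  have d: "sqrt c0 > 0" using c0 by simp
  define e where "e = sqrt c0 / 2"
  have e: "e > 0" "e < sqrt c0" using d by (auto simp: e_def)
  have "eventually (\<lambda>r. e < u r) (at_right 0)"
    using u e(2) by (rule order_tendstoD)
  then obtain r2 where r2: "r2 > 0" "\<And>r. 0 < r \<Longrightarrow> r < r2 \<Longrightarrow> e < u r"
    by (auto simp: eventually_at_right_field)
  obtain b where b: "b \<ge> 1" "\<And>t. t \<in> {0..1} \<Longrightarrow> \<bar>S (rad t)\<bar> \<le> b" "\<And>t. t \<in> {0..1} \<Longrightarrow> \<bar>D (rad t)\<bar> \<le> b"
    using bounded_coeffs[OF zero_le_one] by metis
  define k where "k = (1 + b) / e"
  define K where "K = 4 * k * b / e + 2 * k / e"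
  define r1 where "r1 = min 1 r2"
  have k: "k > 0" using b e by (simp add: k_def)
  have K: "K \<ge> 0" using k b e by (simp add: K_def)
  show thesis
  proof (rule that[OF K])
    show "r1 > 0" using r2 by (simp add: r1_def)
    fix r assume r: "0 < r" "r < r1"
    have ur: "u r > e" "r < 1" using r r2(2)[of r] by (auto simp: r1_def)
    have "r powr (a - 1) \<le> 1 powr (a - 1)" using r ur a by (intro powr_mono2) auto
    then have SD: "\<bar>S r\<bar> \<le> b" "\<bar>D r\<bar> \<le> b"
      using b(2,3)[of "r powr (a - 1)"] r by (auto simp: rad_powr)
    define x where "x = 2 * v r * u r"
    define y where "y = \<theta> r (u r) (v r)"
    have rv: "\<bar>r * v r\<bar> \<le> \<bar>x\<bar> / (2 * e)"
    proof -
      have "\<bar>r * v r\<bar> = r * \<bar>x\<bar> / (2 * u r)" using ur e r by (simp add: x_def abs_mult)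
      also have "\<dots> \<le> 1 * \<bar>x\<bar> / (2 * e)" using ur e r by (intro frac_le mult_right_mono) auto
      finally show ?thesis by simp
    qed
    have y: "\<bar>y\<bar> \<le> k * (1 + \<bar>x\<bar>)"
    proof -
      have "\<bar>y\<bar> \<le> \<bar>r * v r\<bar> + \<bar>S r\<bar> / \<bar>u r\<bar>"
        unfolding y_def \<theta>_def by (rule order_trans[OF abs_triangle_ineq4]) (simp add: abs_divide)
      also have "\<dots> \<le> \<bar>x\<bar> / (2 * e) + b / e"
        using rv SD ur e b by (intro add_mono frac_le) auto
      also have "\<dots> \<le> k * (1 + \<bar>x\<bar>)"
        using e b by (simp add: k_def field_simps)
      finally show ?thesis .
    qed
    define E where "E = - 2 * y * D r / u r + 2 * (r * v r) * y"
    have "\<bar>E\<bar> \<le> \<bar>- 2 * y * D r / u r\<bar> + \<bar>2 * (r * v r) * y\<bar>"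
      unfolding E_def by (rule abs_triangle_ineq)
    also have "\<dots> = 2 * (\<bar>y\<bar> * \<bar>D r\<bar> / \<bar>u r\<bar>) + 2 * (\<bar>r * v r\<bar> * \<bar>y\<bar>)"
      by (simp add: abs_mult abs_divide)
    also have "\<dots> \<le> 2 * ((k * (1 + \<bar>x\<bar>)) * b / e) + 2 * (\<bar>x\<bar> / (2 * e) * (k * (1 + \<bar>x\<bar>)))"
      using y SD ur e b k rv by (intro add_mono mult_left_mono frac_le mult_mono) auto
    also have "\<dots> = (2 * k * b / e) * (1 + \<bar>x\<bar>) + (k / e) * (\<bar>x\<bar> * (1 + \<bar>x\<bar>))"
      using e by (simp add: field_simps)
    also have "\<dots> \<le> (2 * k * b / e) * (2 * (1 + x^2)) + (k / e) * (2 * (1 + x^2))"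
    proof (intro add_mono mult_left_mono)
      have "0 \<le> (\<bar>x\<bar> - 1)^2 + x^2 + 3" "0 \<le> (\<bar>x\<bar> - 1)^2 + 3 * x^2 + 1" by simp_all
      then show "1 + \<bar>x\<bar> \<le> 2 * (1 + x^2)" "\<bar>x\<bar> * (1 + \<bar>x\<bar>) \<le> 2 * (1 + x^2)"
        by (simp_all add: power2_diff power2_eq_square algebra_simps)
    qed (use k b e in auto)
    also have "\<dots> = K * (1 + x^2)" by (simp add: K_def field_simps)
    finally have E: "\<bar>E\<bar> \<le> K * (1 + x^2)" .
    have "DERIV (\<lambda>r. arctan (2 * v r * u r)) r :> inverse (1 + x^2) * (r powr (a - 2) * E)"
      unfolding x_def E_def y_def
      using DERIV_chain2[OF DERIV_arctan DERIV_chi[OF r(1) flow[OF r(1)]]] .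
    moreover have "\<bar>inverse (1 + x^2) * (r powr (a - 2) * E)\<bar> \<le> K * r powr (a - 2)"
    proof -
      have pos: "1 + x^2 > 0" by (simp add: add_pos_nonneg)
      have "\<bar>inverse (1 + x^2) * (r powr (a - 2) * E)\<bar> = r powr (a - 2) * (\<bar>E\<bar> / (1 + x^2))"
        using pos by (simp add: abs_mult divide_inverse)
      also have "\<dots> \<le> r powr (a - 2) * K"
        using pos E by (intro mult_left_mono) (auto simp: divide_le_eq)
      finally show ?thesis by (simp add: mult.commute)
    qed
    ultimately show "\<exists>y. DERIV (\<lambda>r. arctan (2 * v r * u r)) r :> y \<and> \<bar>y\<bar> \<le> K * r powr (a - 2)"
      by blast
  qed
qed

text \<open>The expansion of \<open>u\<^sup>2\<close> to order \<open>r powr (a + 1)\<close> and Cauchy's mean value theorem give points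
  \<open>\<xi> r \<in> (r/2, r)\<close> along which \<open>2 * v * u\<close> tends to \<open>c1\<close>; the derivative bound for its arctangent
  carries the limit over to all \<open>r\<close>.\<close>
lemma v_limit:
  assumes flow: "\<And>r. r > 0 \<Longrightarrow> flow u v r"
    and u: "(u \<longlongrightarrow> sqrt c0) (at_right 0)"
    and e: "(e \<longlongrightarrow> 0) (at_right 0)" and dl: "dl > 0"
    and W: "\<And>r. 0 < r \<Longrightarrow> r \<le> dl \<Longrightarrow>
      W u r = c0 + c1 / (a + 1) * r powr (a + 1) + c3 * r powr (2 * a) + e r * r powr (2 * a)"
  shows "(v \<longlongrightarrow> c1 / (2 * sqrt c0)) (at_right 0)"
proof -
  have a: "a > 1" by (rule a_gt_1)
  have d: "sqrt c0 > 0" using c0 by simp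
  have ev: "eventually (\<lambda>r. r > 0) (at_right (0::real))" by (rule eventually_at_right_less)
  define chi where "chi r = 2 * v r * u r" for r
  \<comment> \<open>The comparison function is r^(a+1) because its derivative shares the factor r^a
    with that of \<open>W\<close>: the quotient of increments is chi(x)/(a+1).\<close>
  have "\<exists>x. r / 2 < x \<and> x < r \<and>
      (W u r - W u (r / 2)) * ((a + 1) * x powr a) = (r powr (a + 1) - (r / 2) powr (a + 1)) * (x powr a * chi x)"
    if r: "r > 0" for r
  proof -
    have dW: "DERIV (W u) x :> x powr a * chi x" if "x > 0" for x
      unfolding chi_def by (rule DERIV_W[OF that flow[OF that]])
    have dp: "DERIV (\<lambda>r. r powr (a + 1)) x :> (a + 1) * x powr a" if "x > 0" for x
      using DERIV_powr_const[OF that, of "a + 1"] that by (simp add: powr_add mult.assoc)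
    have "\<exists>x>r / 2. x < r \<and> (W u r - W u (r / 2)) * ((a + 1) * x powr a)
        = (r powr (a + 1) - (r / 2) powr (a + 1)) * (x powr a * chi x)"
      using r by (intro GMVT' dW dp DERIV_isCont[OF dW] DERIV_isCont[OF dp]) auto
    then show ?thesis by blast
  qed
  then obtain \<xi> where xi: "\<And>r. r > 0 \<Longrightarrow> r / 2 < \<xi> r \<and> \<xi> r < r \<and>
      (W u r - W u (r / 2)) * ((a + 1) * \<xi> r powr a)
        = (r powr (a + 1) - (r / 2) powr (a + 1)) * (\<xi> r powr a * chi (\<xi> r))"
    by metis
  define s where "s = (1 / 2 :: real) powr (a + 1)"
  define s2 where "s2 = (1 / 2 :: real) powr (2 * a)"
  have s: "s < 1" using a powr_less_mono2[of "a + 1" "1/2" 1] by (simp add: s_def)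
  \<comment> \<open>The same quotient computed from the expansion. As r^(2a) = r^(a+1) r^(a-1),
    everything beyond c1 carries r^(a-1); s and s2 are the factors by which r^(a+1) and r^(2a)
    shrink under halving r.\<close>
  define q where "q r = c1 + (a + 1) * r powr (a - 1) * (c3 + e r - (c3 + e (r / 2)) * s2) / (1 - s)" for r
  have chi_xi: "eventually (\<lambda>r. chi (\<xi> r) = q r) (at_right 0)"
  proof -
    have "eventually (\<lambda>r. r < dl) (at_right 0)"
      using dl by (auto simp: eventually_at_right_field)
    with ev show ?thesis
    proof eventually_elim
      case (elim r)
      define p where "p = r powr (a + 1)"
      have p: "p > 0" using elim by (simp add: p_def)
      have p1: "(r / 2) powr (a + 1) = p * s"
        using elim powr_mult[of r "1/2" "a + 1"] by (simp add: p_def s_def)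
      have p2: "r powr (2 * a) = p * r powr (a - 1)"
        by (simp add: p_def flip: powr_add)
      have p3: "(r / 2) powr (2 * a) = p * r powr (a - 1) * s2"
        using elim powr_mult[of r "1/2" "2 * a"] p2 by (simp add: s2_def)
      have x: "\<xi> r > 0" using xi[of r] elim by linarith
      have "(W u r - W u (r / 2)) * ((a + 1) * \<xi> r powr a) = (p - p * s) * (\<xi> r powr a * chi (\<xi> r))"
        using xi[of r] elim unfolding p1 p_def[symmetric] by blast
      then have "((W u r - W u (r / 2)) * (a + 1)) * \<xi> r powr a = (p * (1 - s) * chi (\<xi> r)) * \<xi> r powr a"
        by (simp add: algebra_simps)
      then have eq: "(W u r - W u (r / 2)) * (a + 1) = p * (1 - s) * chi (\<xi> r)"
        using x by (subst (asm) mult_cancel_right) simp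
      have Wd: "W u r - W u (r / 2) = c1 / (a + 1) * (p * (1 - s))
          + p * (r powr (a - 1) * (c3 + e r - (c3 + e (r / 2)) * s2))"
      proof -
        define c where "c = c1 / (a + 1)"
        have "W u r = c0 + c * p + c3 * (p * r powr (a - 1)) + e r * (p * r powr (a - 1))"
          using W[of r] elim unfolding p2 p_def[symmetric] c_def by simp
        moreover have "W u (r / 2) = c0 + c * (p * s) + c3 * (p * r powr (a - 1) * s2)
            + e (r / 2) * (p * r powr (a - 1) * s2)"
          using W[of "r / 2"] elim unfolding p1 p3 c_def by simp
        ultimately show ?thesis unfolding c_def[symmetric] by (simp add: algebra_simps)
      qed
      have "p * (1 - s) * chi (\<xi> r) = (a + 1) * (c1 / (a + 1)) * (p * (1 - s))
          + p * ((a + 1) * (r powr (a - 1) * (c3 + e r - (c3 + e (r / 2)) * s2)))"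
        unfolding eq[symmetric] Wd by (simp only: algebra_simps)
      also have "(a + 1) * (c1 / (a + 1)) = c1" using a by simp
      also have "c1 * (p * (1 - s)) + p * ((a + 1) * (r powr (a - 1) * (c3 + e r - (c3 + e (r / 2)) * s2)))
        = p * (1 - s) * q r"
        using s by (simp add: q_def field_simps)
      finally show ?case using p s by simp
    qed
  qed
  have "LIM r at_right 0. r / 2 :> at_right (0::real)"
    by real_asymp
  from filterlim_compose[OF e this] have e_half: "((\<lambda>r. e (r / 2)) \<longlongrightarrow> 0) (at_right 0)" .
  have "(q \<longlongrightarrow> c1 + (a + 1) * 0 * (c3 + 0 - (c3 + 0) * s2) / (1 - s)) (at_right 0)"
    unfolding q_def using s a
    by (intro tendsto_add tendsto_divide tendsto_mult tendsto_diff tendsto_const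
        tendsto_powr_at_right_0 e e_half) auto
  then have "(q \<longlongrightarrow> c1) (at_right 0)" by simp
  moreover have "eventually (\<lambda>r. q r = chi (\<xi> r)) (at_right 0)"
    using chi_xi by eventually_elim simp
  ultimately have "((\<lambda>r. chi (\<xi> r)) \<longlongrightarrow> c1) (at_right 0)"
    by (rule Lim_transform_eventually)
  then have atan: "((\<lambda>r. arctan (chi (\<xi> r))) \<longlongrightarrow> arctan c1) (at_right 0)"
    by (rule tendsto_arctan)
  obtain K r1 where K: "K \<ge> 0" "r1 > 0" "\<And>r. \<lbrakk>0 < r; r < r1\<rbrakk> \<Longrightarrow>
    \<exists>y. DERIV (\<lambda>r. arctan (2 * v r * u r)) r :> y \<and> \<bar>y\<bar> \<le> K * r powr (a - 2)"
    using chi_deriv_bound[OF flow u] by metis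
  \<comment> \<open>The primitive, vanishing at 0, of the bound for the derivative of the
    arctangent; it dominates the variation between the intermediate point and r.\<close>
  define G where "G r = K / (a - 1) * r powr (a - 1)" for r
  have dG: "DERIV G r :> K * r powr (a - 2)" if "r > 0" for r
  proof -
    have "r powr (a - 1) / r = r powr (a - 2)"
      using that by (simp add: powr_diff powr_numeral power2_eq_square)
    moreover have "K / (a - 1) * ((a - 1) * r powr (a - 1) / r) = K * (r powr (a - 1) / r)"
      using a by simp
    ultimately have "K / (a - 1) * ((a - 1) * r powr (a - 1) / r) = K * r powr (a - 2)"
      by simp
    with DERIV_cmult[OF DERIV_powr_const[OF that, of "a - 1"], of "K / (a - 1)"]
    show ?thesis unfolding G_def by simp
  qed
  have close: "\<bar>arctan (chi r) - arctan (chi (\<xi> r))\<bar> \<le> G r" if r: "0 < r" "r < r1" for r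
  proof -
    have x: "0 < \<xi> r" "\<xi> r < r" using xi[OF r(1)] r by linarith+
    have "arctan (chi (\<xi> r)) + G (\<xi> r) \<le> arctan (chi r) + G r"
    proof (rule DERIV_nonneg_imp_nondecreasing[of "\<xi> r" r "\<lambda>r. arctan (chi r) + G r"])
      fix z assume z: "\<xi> r \<le> z" "z \<le> r"
      then have z': "0 < z" "z < r1" using x r by auto
      obtain y where "DERIV (\<lambda>r. arctan (chi r)) z :> y" "\<bar>y\<bar> \<le> K * z powr (a - 2)"
        unfolding chi_def using K(3)[OF z'] by blast
      with DERIV_add[OF this(1) dG[OF z'(1)]]
      show "\<exists>y. DERIV (\<lambda>r. arctan (chi r) + G r) z :> y \<and> 0 \<le> y"
        by (intro exI[of _ "y + K * z powr (a - 2)"]) auto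
    qed (use x in simp)
    moreover have "arctan (chi r) - G r \<le> arctan (chi (\<xi> r)) - G (\<xi> r)"
    proof (rule DERIV_nonpos_imp_nonincreasing[of "\<xi> r" r "\<lambda>r. arctan (chi r) - G r"])
      fix z assume z: "\<xi> r \<le> z" "z \<le> r"
      then have z': "0 < z" "z < r1" using x r by auto
      obtain y where "DERIV (\<lambda>r. arctan (chi r)) z :> y" "\<bar>y\<bar> \<le> K * z powr (a - 2)"
        unfolding chi_def using K(3)[OF z'] by blast
      with DERIV_diff[OF this(1) dG[OF z'(1)]]
      show "\<exists>y. DERIV (\<lambda>r. arctan (chi r) - G r) z :> y \<and> y \<le> 0"
        by (intro exI[of _ "y - K * z powr (a - 2)"]) auto
    qed (use x in simp)
    moreover have "G (\<xi> r) \<ge> 0" using K(1) a by (simp add: G_def)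
    ultimately show ?thesis by linarith
  qed
  have "(G \<longlongrightarrow> K / (a - 1) * 0) (at_right 0)"
    unfolding G_def using a by (intro tendsto_intros tendsto_powr_at_right_0) auto
  then have "(G \<longlongrightarrow> 0) (at_right 0)" by simp
  moreover have "eventually (\<lambda>r. norm (arctan (chi r) - arctan (chi (\<xi> r))) \<le> G r) (at_right 0)"
    unfolding eventually_at_right_field using K(2) close by auto
  ultimately have "((\<lambda>r. arctan (chi r) - arctan (chi (\<xi> r))) \<longlongrightarrow> 0) (at_right 0)"
    by (rule Lim_null_comparison[rotated])
  from tendsto_add[OF this atan] have "((\<lambda>r. arctan (chi r)) \<longlongrightarrow> arctan c1) (at_right 0)" by simp
  \<comment> \<open>The limit arctan c1 lies strictly between -pi/2 and pi/2, where the tangent is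
    continuous, so chi itself converges.\<close>
  from tendsto_tan[OF this] have "(chi \<longlongrightarrow> c1) (at_right 0)"
    by (simp add: tan_arctan)
  from tendsto_divide[OF this tendsto_mult[OF tendsto_const u, of 2]]
  have "((\<lambda>r. chi r / (2 * u r)) \<longlongrightarrow> c1 / (2 * sqrt c0)) (at_right 0)"
    using d by simp
  then show ?thesis
  proof (rule Lim_transform_eventually)
    show "eventually (\<lambda>r. chi r / (2 * u r) = v r) (at_right 0)"
      using ev
    proof eventually_elim
      case (elim r)
      then show ?case using flow[OF elim] by (simp add: chi_def flow_def)
    qed
  qed
qed

end

section \<open>Existence and uniqueness of the solution\<close>

context soliton
begin

text \<open>Continuity of the second derivative comes from the equation, solved for it by dividing
  by 2 r^2 h > 0.\<close>

lemma h_ode_imp_C2: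
  assumes h: "\<And>r. r > 0 \<Longrightarrow> h_ode h h1 h2 r" and m: "n = real m"
  shows "C2_on h {0<..}" "positive_ode_solution m l h" "\<And>r. r > 0 \<Longrightarrow> deriv h r = h1 r"
proof -
  have dh: "DERIV h r :> h1 r" and dh1: "DERIV h1 r :> h2 r" and pos: "h r > 0"
    and ode: "2 * r^2 * h r * h2 r = (n - 1) * h r * (h r - 1) + r * h1 r * (r * h1 r - l * r - (n - 1))"
    if "r > 0" for r
    using h[OF that] by (auto simp: h_ode_def)
  show d1: "deriv h r = h1 r" if "r > 0" for r
    using dh[OF that] by (rule DERIV_imp_deriv)
  have dd: "DERIV (deriv h) r :> h2 r" if "r > 0" for r
    using dh1[OF that]
    by (rule has_field_derivative_transform_within_open[of _ _ _ "{0<..}"]) (use that d1 in auto)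
  have c: "continuous_on {0<..} h" "continuous_on {0<..} h1"
    using dh dh1 by (meson DERIV_isCont continuous_at_imp_continuous_on greaterThan_iff)+
  have "continuous_on {0<..} (\<lambda>r. ((n - 1) * h r * (h r - 1) + r * h1 r * (r * h1 r - l * r - (n - 1))) / (2 * r^2 * h r))"
    using pos by (intro continuous_intros c) (force simp: less_imp_neq[symmetric])
  then have c2: "continuous_on {0<..} h2"
  proof (rule continuous_on_eq)
    fix r :: real assume "r \<in> {0<..}"
    then have r: "r > 0" by simp
    show "((n - 1) * h r * (h r - 1) + r * h1 r * (r * h1 r - l * r - (n - 1))) / (2 * r^2 * h r) = h2 r"
      unfolding ode[OF r, symmetric] using r pos[OF r] by simp
  qed
  show "C2_on h {0<..}"
    unfolding C2_on_def C1_differentiable_on_def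
    using dh dd c(2) c2 by (auto simp: has_real_derivative_iff_has_vector_derivative)
  show "positive_ode_solution m l h"
    unfolding positive_ode_solution_def
    using pos ode d1 DERIV_imp_deriv[OF dd] by (simp add: m)
qed

lemma C2_imp_h_ode:
  assumes "C2_on g {0<..}" "positive_ode_solution m l g" "n = real m" "r > 0"
  shows "h_ode g (deriv g) (deriv (deriv g)) r"
proof -
  obtain D1 D2 where "\<And>r. r > 0 \<Longrightarrow> DERIV g r :> D1 r" "\<And>r. r > 0 \<Longrightarrow> DERIV (deriv g) r :> D2 r"
    using assms(1) unfolding C2_on_def C1_differentiable_on_def
    by (auto simp: has_real_derivative_iff_has_vector_derivative)
  then have "DERIV g r :> deriv g r" "DERIV (deriv g) r :> deriv (deriv g) r"
    using assms(4) DERIV_deriv_iff_real_differentiable real_differentiable_def by blast+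
  then show ?thesis
    using assms(2,4) unfolding positive_ode_solution_def assms(3)[symmetric]
    by (simp add: h_ode_def)
qed

lemma c3_eq: "c2 = (n - 1) * (a - 1) / 2 \<Longrightarrow> c3 = (c2^2 + (n - 1) * c2) / (4 * c0 * a * (a - 1))"
proof -
  assume "c2 = (n - 1) * (a - 1) / 2"
  then have "2 * A = c2" by (simp add: A_def)
  then show ?thesis by (simp add: c3_def)
qed

text \<open>The r^a term and the two terms with l are exactly those absorbed by \<open>W\<close>.
  Multiplying by r^a and moving them over gives an expansion with the same remainder e.\<close>

lemma h_expansion_iff_W:
  assumes c2: "c2 = (n - 1) * (a - 1) / 2" and m: "n = real m"
    and u: "\<And>r. r > 0 \<Longrightarrow> h r = r powr (- a) * (u r)^2"
  shows "h_expansion m l a c0 c1 c2 dl h \<longleftrightarrow> (\<exists>e. (e \<longlongrightarrow> 0) (at_right 0) \<and> (\<forall>r. 0 < r \<and> r \<le> dl \<longrightarrow>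
    W u r = c0 + c1 / (a + 1) * r powr (a + 1) + c3 * r powr (2 * a) + e r * r powr (2 * a)))"
proof -
  have a: "a > 1" by (rule a_gt_1)
  have "h r = 1 / r powr a *
            (c0 - c2 / a * r powr a
             + (c1 / (a + 1) - a * l / (2 * (a + 1)^2)) * r powr (a + 1)
             + a * l / (2 * a + 2) * r powr (a + 1) * ln r
             + (c2^2 + (real m - 1) * c2) / (4 * c0 * a * (a - 1)) * r powr (2 * a)
             + e * r powr (2 * a)) \<longleftrightarrow>
    W u r = c0 + c1 / (a + 1) * r powr (a + 1) + c3 * r powr (2 * a) + e * r powr (2 * a)"
    if r: "r > 0" for r e
  proof -
    define p q where "p = r powr a" and "q = r powr (a + 1)"
    have p: "p > 0" using r by (simp add: p_def)
    define x y z w where "x = 2 * A / a" and "y = 2 * B / (a + 1)^2" and "z = 2 * B / (a + 1)"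
      and "w = c1 / (a + 1)"
    have hr: "h r = 1 / p * (u r)^2" using u[OF r] by (simp add: p_def powr_minus divide_inverse)
    have coeffs: "c2 / a = x" "a * l / (2 * (a + 1)^2) = y" "a * l / (2 * a + 2) = z"
      using a by (simp_all add: x_def y_def z_def c2 A_def B_def field_simps)
    have "W u r = (u r)^2 + x * p - (z * q * ln r - y * q)"
      by (simp add: W_def x_def y_def z_def p_def q_def algebra_simps)
    moreover have cancel: "1 / p * s = 1 / p * t \<longleftrightarrow> s = t" for s t using p by simp
    ultimately show ?thesis
      unfolding m[symmetric] c3_eq[OF c2, symmetric] hr coeffs p_def[symmetric] q_def[symmetric]
        w_def[symmetric] cancel
      by (auto simp: algebra_simps)
  qed
  then show ?thesis unfolding h_expansion_def by (intro ex_cong1 conj_cong refl) auto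
qed

text \<open>The remainders are defined for every r > 0 as normalized errors, so the expansions hold
  on (0, dl] for any dl. For the derivative, r^(a+1) h' = 2 r^a u \<open>\<theta>\<close> - a
  u^2.\<close>

lemma flow_imp_admissible:
  assumes c2: "c2 = (n - 1) * (a - 1) / 2" and m: "n = real m"
    and flow: "\<And>r. r > 0 \<Longrightarrow> flow u v r"
    and u: "(u \<longlongrightarrow> sqrt c0) (at_right 0)" and v: "(v \<longlongrightarrow> c1 / (2 * sqrt c0)) (at_right 0)"
  defines "h \<equiv> \<lambda>r. r powr (- a) * (u r)^2"
  shows "admissible m l a c0 c1 c2 dl h" "deriv_expansion m l a c0 c1 c2 dl h"
proof -
  have a: "a > 1" by (rule a_gt_1)
  define f where "f r = r powr (- a / 2) * u r" for r
  define f1 where "f1 r = r powr (- a / 2) * (r powr (a - 1) * \<theta> r (u r) (v r) - a * u r / (2 * r))" for r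
  define f2 where "f2 r = ((n - 1) * f r - (n - 1) / f r - 2 * r * f1 r * (l * r + n - 1) / (f r)^2) / (4 * r^2)" for r
  have prof: "profile f f1 f2 r" if "r > 0" for r
    using flow_imp_profile[OF that flow[OF that]] unfolding f_def f1_def f2_def .
  have hf: "h = (\<lambda>r. (f r)^2)"
    by (rule ext) (simp add: h_def f_def power_mult_distrib power2_eq_square flip: powr_add)
  have ode: "h_ode h (\<lambda>r. 2 * f r * f1 r) (\<lambda>r. 2 * (f1 r)^2 + 2 * f r * f2 r) r" if "r > 0" for r
    unfolding hf by (rule profile_imp_h_ode[OF that prof[OF that]])
  note h = h_ode_imp_C2[OF ode m]
  define e1 where "e1 r = (2 * v r * u r - c1) / r powr (a - 1) - 2 * a * c3" for r
  define e where "e r = (W u r - c0 - c1 / (a + 1) * r powr (a + 1) - c3 * r powr (2 * a)) / r powr (2 * a)" for r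
  note as = flow_asymptotics[OF flow u v]
  have e: "(e \<longlongrightarrow> 0) (at_right 0)" unfolding e_def[abs_def] by (rule as(2))
  have e1: "(e1 \<longlongrightarrow> 0) (at_right 0)"
    using tendsto_diff[OF as(1) tendsto_const[of "2 * a * c3"]] by (simp add: e1_def[abs_def])
  have W: "W u r = c0 + c1 / (a + 1) * r powr (a + 1) + c3 * r powr (2 * a) + e r * r powr (2 * a)"
    if "r > 0" for r using that by (simp add: e_def)
  have exp: "h_expansion m l a c0 c1 c2 dl h"
    by (subst h_expansion_iff_W[OF c2 m]) (use e W in \<open>auto simp: h_def\<close>)
  have "((\<lambda>r. r powr a * h r) \<longlongrightarrow> c0) (at_right 0)"
  proof (rule Lim_transform_eventually)
    show "((\<lambda>r. (u r)^2) \<longlongrightarrow> c0) (at_right 0)"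
      using tendsto_power[OF u, of 2] c0 by simp
    show "eventually (\<lambda>r. (u r)^2 = r powr a * h r) (at_right 0)"
      using eventually_at_right_less[of "0::real"] by eventually_elim (simp add: h_def powr_minus)
  qed
  with h(1,2) exp show "admissible m l a c0 c1 c2 dl h" by (simp add: admissible_def)
  have "deriv h r = 1 / r powr (a + 1) *
            (- a * c0
             + (c1 / (a + 1) + a^2 * l / (2 * (a + 1)^2)) * r powr (a + 1)
             + a * l / (2 * a + 2) * r powr (a + 1) * ln r
             + (c2^2 + (real m - 1) * c2) / (4 * c0 * (a - 1)) * r powr (2 * a)
             + (e1 r - a * e r) * r powr (2 * a))" if r: "r > 0" for r
  proof -
    define p where "p = r powr a"
    have p: "p > 0" using r by (simp add: p_def)
    have ur: "u r > 0" using flow[OF r] by (simp add: flow_def)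
    have pw: "r powr (a + 1) = p * r" "r powr (a - 1) = p / r" "r powr (2 * a) = p * p"
      using r powr_add[of r a a] by (auto simp: p_def powr_add powr_diff)
    have "r powr (- a / 2) * r powr (- a / 2) = r powr (- a)" by (simp flip: powr_add)
    then have pp: "r powr (- a / 2) * r powr (- a / 2) = 1 / p"
      by (simp only: p_def powr_minus_divide)
    have "deriv h r = 2 * f r * f1 r" by (rule h(3)) (use r in auto)
    also have "\<dots> = 2 * (r powr (- a / 2) * r powr (- a / 2)) * u r * (r powr (a - 1) * \<theta> r (u r) (v r) - a * u r / (2 * r))"
      by (simp add: f_def f1_def)
    also have "\<dots> = 1 / (p * r) * (2 * p * (u r * \<theta> r (u r) (v r)) - a * (u r)^2)"
      unfolding pp pw using p r by (simp add: field_simps power2_eq_square)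
    also have "u r * \<theta> r (u r) (v r) = r * (v r * u r) - S r"
      using ur by (simp add: \<theta>_def field_simps)
    also have "v r * u r = (c1 + (e1 r + 2 * a * c3) * (p / r)) / 2"
      using p r by (simp add: e1_def pw)
    also have "(u r)^2 = (c0 + c1 / (a + 1) * (p * r) + c3 * (p * p) + e r * (p * p))
        - 2 * A / a * p + 2 * B * (p * r * ln r / (a + 1) - p * r / (a + 1)^2)"
      using W[OF r] unfolding W_def pw p_def[symmetric] by simp
    finally have "deriv h r = 1 / (p * r) * (2 * p * (r * ((c1 + (e1 r + 2 * a * c3) * (p / r)) / 2) - S r)
      - a * ((c0 + c1 / (a + 1) * (p * r) + c3 * (p * p) + e r * (p * p))
        - 2 * A / a * p + 2 * B * (p * r * ln r / (a + 1) - p * r / (a + 1)^2)))" .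
    \<comment> \<open>The r^a contributions -2 A p and a * (2 A/a) p cancel, so h' has no such term.
      The remainder is e1 - a e, and the r^(2a) coefficient is 2 a c3 - a c3 = a c3.\<close>
    also have "2 * p * (r * ((c1 + (e1 r + 2 * a * c3) * (p / r)) / 2) - S r)
      - a * ((c0 + c1 / (a + 1) * (p * r) + c3 * (p * p) + e r * (p * p))
        - 2 * A / a * p + 2 * B * (p * r * ln r / (a + 1) - p * r / (a + 1)^2))
      = - a * c0 + (c1 * (1 - a / (a + 1)) + 2 * a * B / (a + 1)^2) * (p * r)
        + 2 * B * (1 - a / (a + 1)) * (p * r) * ln r + a * c3 * (p * p) + (e1 r - a * e r) * (p * p)"
    proof -
      define k where "k = 2 * A / a"
      have Ak: "A = a * k / 2" using a by (simp add: k_def)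
      have r1: "r * ((c1 + (e1 r + 2 * a * c3) * (p / r)) / 2) = (c1 * r + (e1 r + 2 * a * c3) * p) / 2"
        using r by (simp add: field_simps)
      show ?thesis
        unfolding r1 k_def[symmetric] S_def by (simp add: Ak algebra_simps)
    qed
    also have "1 - a / (a + 1) = 1 / (a + 1)" using a by (simp add: field_simps)
    also have "2 * a * B / (a + 1)^2 = a^2 * l / (2 * (a + 1)^2)"
      by (simp add: B_def power2_eq_square)
    also have "2 * B * (1 / (a + 1)) = a * l / (2 * a + 2)"
      using a by (simp add: B_def field_simps)
    also have "a * c3 = (c2^2 + (real m - 1) * c2) / (4 * c0 * (a - 1))"
      unfolding c3_eq[OF c2] m[symmetric] using a by simp
    finally show ?thesis unfolding pw by simp
  qed
  moreover have "((\<lambda>r. e1 r - a * e r) \<longlongrightarrow> 0) (at_right 0)"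
    using tendsto_diff[OF e1 tendsto_mult[OF tendsto_const e, of a]] by simp
  ultimately show "deriv_expansion m l a c0 c1 c2 dl h"
    unfolding deriv_expansion_def by (intro exI[of _ "\<lambda>r. e1 r - a * e r"]) simp
qed

text \<open>Everything except the limit of v is a change of variables. That limit is where the
  expansion, and with it c1, enters.\<close>

lemma admissible_imp_flow:
  assumes c2: "c2 = (n - 1) * (a - 1) / 2" and m: "n = real m" and dl: "dl > 0"
    and g: "admissible m l a c0 c1 c2 dl g"
  obtains u v where "\<And>r. r > 0 \<Longrightarrow> flow u v r" "(u \<longlongrightarrow> sqrt c0) (at_right 0)"
    "(v \<longlongrightarrow> c1 / (2 * sqrt c0)) (at_right 0)" "\<And>r. r > 0 \<Longrightarrow> g r = r powr (- a) * (u r)^2"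
proof -
  have g': "C2_on g {0<..}" "positive_ode_solution m l g" "h_expansion m l a c0 c1 c2 dl g"
    "((\<lambda>r. r powr a * g r) \<longlongrightarrow> c0) (at_right 0)"
    using g by (auto simp: admissible_def)
  have pos: "g r > 0" if "r > 0" for r using g'(2) that by (simp add: positive_ode_solution_def)
  define u where "u r = r powr (a / 2) * sqrt (g r)" for r
  obtain v where flow: "\<And>r. r > 0 \<Longrightarrow> flow u v r"
    using profile_imp_flow[OF _ h_ode_imp_profile[OF _ C2_imp_h_ode[OF g'(1,2) m]]]
    unfolding u_def by blast
  have u2: "(u r)^2 = r powr a * g r" if "r > 0" for r
  proof -
    have "(r powr (a / 2))^2 = r powr a" by (simp add: power2_eq_square flip: powr_add)
    then show ?thesis using pos[OF that] by (simp add: u_def power_mult_distrib)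
  qed
  have gu: "g r = r powr (- a) * (u r)^2" if "r > 0" for r
    using that by (simp add: u2 powr_minus)
  have u: "(u \<longlongrightarrow> sqrt c0) (at_right 0)"
  proof (rule Lim_transform_eventually[OF tendsto_real_sqrt[OF g'(4)]])
    show "eventually (\<lambda>r. sqrt (r powr a * g r) = u r) (at_right 0)"
      using eventually_at_right_less[of "0::real"]
    proof eventually_elim
      case (elim r)
      have "u r \<ge> 0" using pos[OF elim] by (simp add: u_def)
      then show ?case by (simp flip: u2[OF elim])
    qed
  qed
  obtain e where e: "(e \<longlongrightarrow> 0) (at_right 0)" "\<And>r. 0 < r \<Longrightarrow> r \<le> dl \<Longrightarrow>
      W u r = c0 + c1 / (a + 1) * r powr (a + 1) + c3 * r powr (2 * a) + e r * r powr (2 * a)"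
    using g'(3) h_expansion_iff_W[OF c2 m gu, of dl] by auto
  have "(v \<longlongrightarrow> c1 / (2 * sqrt c0)) (at_right 0)"
    by (rule v_limit[OF flow u e(1) dl e(2)])
  then show thesis using that flow u gu by blast
qed

end

theorem theorem1p2:
  fixes n :: nat and l \<alpha> c0 c1 c2 :: real
  assumes "n > 4"
    and "l \<ge> 0"
    and "\<alpha> = sqrt (real n) - 1"
    and "c0 > 0"
    and "c2 = (real n - 1) * (\<alpha> - 1) / 2"
  shows "\<exists>\<delta>. 0 < \<delta> \<and> \<delta> < 1 \<and>
    (\<exists>h. admissible n l \<alpha> c0 c1 c2 \<delta> h \<and>
         (\<forall>g. admissible n l \<alpha> c0 c1 c2 \<delta> g \<longrightarrow> (\<forall>r>0. g r = h r)) \<and>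
         deriv_expansion n l \<alpha> c0 c1 c2 \<delta> h)"
proof -
  interpret soliton "real n" l \<alpha> c0 c1
    using assms by unfold_locales auto
  obtain u v where uv: "\<And>r. r > 0 \<Longrightarrow> flow u v r"
    "(u \<longlongrightarrow> sqrt c0) (at_right 0)" "(v \<longlongrightarrow> c1 / (2 * sqrt c0)) (at_right 0)"
    using global_flow by blast
  define h where "h r = r powr (- \<alpha>) * (u r)^2" for r
  \<comment> \<open>The radius 1/2 is a choice: the constructed solution has its expansions on every
    interval (0, dl].\<close>
  have "admissible n l \<alpha> c0 c1 c2 (1 / 2) h" "deriv_expansion n l \<alpha> c0 c1 c2 (1 / 2) h"
    using flow_imp_admissible[OF assms(5) refl uv] unfolding h_def by blast+
  moreover have "g r = h r" if g: "admissible n l \<alpha> c0 c1 c2 (1 / 2) g" and r: "r > 0" for g r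
  proof -
    obtain u' v' where u': "\<And>r. r > 0 \<Longrightarrow> flow u' v' r" "(u' \<longlongrightarrow> sqrt c0) (at_right 0)"
      "(v' \<longlongrightarrow> c1 / (2 * sqrt c0)) (at_right 0)" "\<And>r. r > 0 \<Longrightarrow> g r = r powr (- \<alpha>) * (u' r)^2"
      using admissible_imp_flow[OF assms(5) refl _ g] by auto
    have "u' r = u r" by (rule flow_unique[OF u'(1-3) uv r])
    then show ?thesis using u'(4)[OF r] by (simp add: h_def)
  qed
  ultimately show ?thesis
    by (intro exI[of _ "1 / 2"] conjI exI[of _ h]) auto
qed

end
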